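(* Let $\mathbb{K}$ be a field of characteristic zero, $(G,\preceq)$ a partially ordered abelian group, and let $A=Q/I$ with $I=\operatorname{Ann}(f)$ be an Artinian Cox-Gorenstein $G$-graded $\mathbb{K}$-algebra, where $f\in S$ is homogeneous. Let $A_g$ and $A_h$ be two linearly comparable graded pieces of $A$ with $h=g+kl$, let $\phi\in\operatorname{Hom}_{\mathbb Z}(G,\mathbb{Q})$, and let $L=a_1X_1+\cdots+a_mX_m\in\mathcal{L}_l$ be a $\phi$-linear element, where $\phi(\deg(f))\in\mathbb{Z}_+$. Let $\mathcal{B}$ and $\mathcal{C}$ be $\mathbb{K}$-bases of $A_g$ and $A_h$. Then the matrix of the $\mathbb{K}$-linear multiplication map $\bullet L^k:A_g\to A_h$ with respect to the bases $\mathcal{B}$ and $\mathcal{C}$ is $$[\,\cdot L^k\,]_{\mathcal{B}}^{\mathcal{C}}=k!\cdot\operatorname{Hess}_f^{(\mathcal{C}^*,\mathcal{B})}(a),\qquad a=(a_1,\dots,a_m,0,\dots,0).$$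
   Context: $S=\mathbb{K}[x_1,\dots,x_s]$ is a $G$-graded polynomial ring and $Q=\mathbb{K}[X_1,\dots,X_s]$ acts on $S$ by $X_i=\partial/\partial x_i$, with $\deg X_i=\deg x_i$. Graded algebras are always assumed to have degree-$0$ piece $\mathbb{K}$. $\operatorname{Ann}(f)=\{\alpha\in Q\mid\alpha(f)=0\}$, so $A$ acts on $f$. An Artinian $A=Q/I$ is Cox-Gorenstein with socle degree $\omega$ if $(0:_A\mathfrak m)=A_\omega\simeq\mathbb{K}$, $\mathfrak m=(\overline{X_1},\dots,\overline{X_s})$; here $\omega=\deg f$. $\mathcal{L}\subseteq A$ is the $\mathbb{K}$-span of the classes of the variables and $\mathcal{L}_l=\mathcal{L}\cap A_l$; the variables are numbered so that $X_1,\dots,X_m$ are those of degree $l$. $A_g$ and $A_h$ are linearly comparable if $g\preceq h$ and there is $L\in\mathcal{L}_l$ with $h=g+kl$ for some $k\in\mathbb{Z}_+$. $L\in\mathcal{L}_l$ is $\phi$-linear if $\phi(\deg L)=\phi(l)=1$. For bases $\mathcal{B}'=\{\beta_1,\dots,\beta_p\}$, $\mathcal{C}'=\{\gamma_1,\dots,\gamma_t\}$ of two graded pieces of $A$, the toric mixed Hessian of $f$ is the matrix of polynomials $\operatorname{Hess}_f^{(\mathcal{B}',\mathcal{C}')}=[\beta_i\gamma_j(f)]$ with entries in $S$; $(a)$ denotes evaluation of the entries at the point $a\in\mathbb{K}^s$. If $\mathcal{C}=\{\gamma_1,\dots,\gamma_t\}$ is a basis of $A_h$, $\mathcal{C}^*=\{\gamma_1^*,\dots,\gamma_t^*\}$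 is the dual basis of $A_{\omega-h}$ under the perfect pairing $A_h\times A_{\omega-h}\to A_\omega$: $\gamma_i^*\gamma_j=\delta_{ij}\Omega$, where $\Omega\in A_\omega$ is the socle generator with $\Omega(f)=1$. *)

theory Defs
  imports
    "HOL-Library.Poly_Mapping"
    "HOL-Algebra.QuotRing"
    "HOL-Algebra.Embedded_Algebras"
    "HOL-Algebra.Algebraic_Closure_Type"
    "Jordan_Normal_Form.Matrix"
begin

section \<open>Graded polynomial rings and the differential action\<close>

text \<open>The variables are indexed by a finite type. Both \<open>S\<close> and \<open>Q\<close> are rendered by the
  type below; \<open>Q\<close> acts on \<open>S\<close> through \<open>diff_act\<close>.\<close>

type_synonym ('v, 'k) mpol = "('v \<Rightarrow>\<^sub>0 nat) \<Rightarrow>\<^sub>0 'k"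

definition Const :: "'k \<Rightarrow> ('v, 'k::zero) mpol" where
  "Const c = Poly_Mapping.single 0 c"

definition Var :: "'v \<Rightarrow> ('v, 'k::zero_neq_one) mpol" where
  "Var i = Poly_Mapping.single (Poly_Mapping.single i 1) 1"

definition eval_at :: "('v::finite \<Rightarrow> 'k) \<Rightarrow> ('v, 'k::comm_semiring_1) mpol \<Rightarrow> 'k" where
  "eval_at a F = (\<Sum>m\<in>Poly_Mapping.keys F.
     Poly_Mapping.lookup F m * (\<Prod>i\<in>UNIV. a i ^ Poly_Mapping.lookup m i))"

definition nat_mult :: "nat \<Rightarrow> 'g::comm_monoid_add \<Rightarrow> 'g" where
  "nat_mult n x = (\<Sum>i<n. x)"

definition mon_deg :: "('v::finite \<Rightarrow> 'g::comm_monoid_add) \<Rightarrow> ('v \<Rightarrow>\<^sub>0 nat) \<Rightarrow> 'g" where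
  "mon_deg d m = (\<Sum>i\<in>UNIV. nat_mult (Poly_Mapping.lookup m i) (d i))"

definition homog :: "('v::finite \<Rightarrow> 'g::comm_monoid_add) \<Rightarrow> 'g \<Rightarrow> ('v, 'k::zero) mpol set" where
  "homog d g = {F. \<forall>m\<in>Poly_Mapping.keys F. mon_deg d m = g}"

text \<open>The grading is given by the degrees \<open>d i\<close> of the variables. The condition expresses the
  standing convention that graded algebras have degree-zero piece \<open>\<K>\<close>.\<close>

definition graded_poly_ring ::
    "('v::finite \<Rightarrow> 'g::comm_monoid_add) \<Rightarrow> 'k::zero itself \<Rightarrow> bool" where
  "graded_poly_ring d _ \<longleftrightarrow> (homog d 0 :: ('v, 'k) mpol set) = {Const c | c. True}"

text \<open>In \<open>partial\<close>, a monomial not containing \<open>x\<^sub>i\<close> contributes \<open>0\<close>, so the truncated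
  subtraction of exponents is harmless.\<close>

definition partial :: "'v \<Rightarrow> ('v, 'k) mpol \<Rightarrow> ('v, 'k::comm_semiring_1) mpol" where
  "partial i F = (\<Sum>m\<in>Poly_Mapping.keys F.
     Poly_Mapping.single (m - Poly_Mapping.single i 1)
       (of_nat (Poly_Mapping.lookup m i) * Poly_Mapping.lookup F m))"

text \<open>The composition of all \<open>(\<partial>/\<partial>x\<^sub>i)\<^bsup>m\<^sub>i\<^esup>\<close>; these operators commute, so the fold is
  independent of the order of the variables.\<close>

definition mon_diff :: "('v::finite \<Rightarrow>\<^sub>0 nat) \<Rightarrow> ('v, 'k) mpol \<Rightarrow> ('v, 'k::comm_semiring_1) mpol" where
  "mon_diff m F = Finite_Set.fold (\<lambda>i. partial i ^^ Poly_Mapping.lookup m i) F UNIV"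

definition diff_act :: "('v::finite, 'k) mpol \<Rightarrow> ('v, 'k) mpol \<Rightarrow> ('v, 'k::comm_semiring_1) mpol" where
  "diff_act \<alpha> F = (\<Sum>m\<in>Poly_Mapping.keys \<alpha>. Const (Poly_Mapping.lookup \<alpha> m) * mon_diff m F)"

definition Ann :: "('v::finite, 'k) mpol \<Rightarrow> ('v, 'k::comm_semiring_1) mpol set" where
  "Ann f = {\<alpha>. diff_act \<alpha> f = 0}"


section \<open>The quotient algebra\<close>

abbreviation polyQ :: "('v, 'k::comm_ring_1) mpol ring" where
  "polyQ \<equiv> ring_of_type_algebra"

abbreviation quot_alg :: "('v, 'k::comm_ring_1) mpol set \<Rightarrow> ('v, 'k) mpol set ring" where
  "quot_alg I \<equiv> polyQ Quot I"

abbreviation cls :: "('v, 'k::comm_ring_1) mpol set \<Rightarrow> ('v, 'k) mpol \<Rightarrow> ('v, 'k) mpol set" where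
  "cls I \<alpha> \<equiv> I +>\<^bsub>polyQ\<^esub> \<alpha>"

text \<open>The image of \<open>\<K>\<close> in \<open>Q/I\<close>; it is a subfield as soon as \<open>I\<close> is proper, and linear algebra
  over \<open>\<K>\<close> in \<open>Q/I\<close> is linear algebra over this subfield in the sense of
  \<open>HOL-Algebra.Embedded_Algebras\<close>.\<close>

definition scalars :: "('v, 'k::comm_ring_1) mpol set \<Rightarrow> ('v, 'k) mpol set set" where
  "scalars I = {cls I (Const c) | c. True}"

definition piece ::
    "('v::finite \<Rightarrow> 'g::comm_monoid_add) \<Rightarrow> ('v, 'k::comm_ring_1) mpol set \<Rightarrow> 'g \<Rightarrow> ('v, 'k) mpol set set" where
  "piece d I g = cls I ` homog d g"

definition is_basis ::
    "('v, 'k::comm_ring_1) mpol set \<Rightarrow> ('v, 'k) mpol set set \<Rightarrow> ('v, 'k) mpol set list \<Rightarrow> bool" where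
  "is_basis I V Bs \<longleftrightarrow>
     ring.independent (quot_alg I) (scalars I) Bs \<and> ring.Span (quot_alg I) (scalars I) Bs = V"

definition artinian_ring :: "('a, 'b) ring_scheme \<Rightarrow> bool" where
  "artinian_ring R \<longleftrightarrow> cring R \<and>
     (\<forall>J :: nat \<Rightarrow> 'a set. (\<forall>n. ideal (J n) R \<and> J (Suc n) \<subseteq> J n) \<longrightarrow> (\<exists>N. \<forall>n\<ge>N. J n = J N))"

definition max_ideal :: "('v, 'k::comm_ring_1) mpol set \<Rightarrow> ('v, 'k) mpol set set" where
  "max_ideal I = Idl\<^bsub>quot_alg I\<^esub> {cls I (Var i) | i. True}"

definition socle :: "('v, 'k::comm_ring_1) mpol set \<Rightarrow> ('v, 'k) mpol set set" where
  "socle I = {u \<in> carrier (quot_alg I). \<forall>v\<in>max_ideal I. u \<otimes>\<^bsub>quot_alg I\<^esub> v = \<zero>\<^bsub>quot_alg I\<^esub>}"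

definition cox_gorenstein ::
    "('v::finite \<Rightarrow> 'g::comm_monoid_add) \<Rightarrow> ('v, 'k::comm_ring_1) mpol set \<Rightarrow> 'g \<Rightarrow> bool" where
  "cox_gorenstein d I \<omega> \<longleftrightarrow>
     socle I = piece d I \<omega> \<and> ring.dimension (quot_alg I) 1 (scalars I) (piece d I \<omega>)"


section \<open>Linear forms\<close>

definition lin_forms :: "('v::finite, 'k::comm_ring_1) mpol set \<Rightarrow> ('v, 'k) mpol set set" where
  "lin_forms I = {cls I (\<Sum>i\<in>UNIV. Const (c i) * Var i) | c. True}"

definition lin_piece ::
    "('v::finite \<Rightarrow> 'g::comm_monoid_add) \<Rightarrow> ('v, 'k::comm_ring_1) mpol set \<Rightarrow> 'g \<Rightarrow> ('v, 'k) mpol set set" where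
  "lin_piece d I l = lin_forms I \<inter> piece d I l"

definition linearly_comparable ::
    "('v::finite \<Rightarrow> 'g::ordered_ab_group_add) \<Rightarrow> ('v, 'k::comm_ring_1) mpol set \<Rightarrow> 'g \<Rightarrow> 'g \<Rightarrow> bool" where
  "linearly_comparable d I g h \<longleftrightarrow>
     g \<le> h \<and> (\<exists>l. \<exists>L\<in>lin_piece d I l. \<exists>k::nat. h = g + nat_mult k l)"

definition phi_linear ::
    "('v::finite \<Rightarrow> 'g::comm_monoid_add) \<Rightarrow> ('v, 'k::comm_ring_1) mpol set \<Rightarrow> ('g \<Rightarrow> rat) \<Rightarrow> 'g
      \<Rightarrow> ('v, 'k) mpol set \<Rightarrow> bool" where
  "phi_linear d I \<phi> l L \<longleftrightarrow> L \<in> lin_piece d I l \<and> \<phi> l = 1"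


section \<open>Dual bases, Hessians and matrices\<close>

text \<open>The action of \<open>Q/Ann(f)\<close> on \<open>f\<close>: all representatives of a class give the same value.\<close>

definition cls_act :: "('v::finite, 'k) mpol set \<Rightarrow> ('v, 'k) mpol \<Rightarrow> ('v, 'k::comm_ring_1) mpol" where
  "cls_act u f = the_elem ((\<lambda>\<alpha>. diff_act \<alpha> f) ` u)"

definition socle_gen ::
    "('v::finite \<Rightarrow> 'g::comm_monoid_add) \<Rightarrow> ('v, 'k::comm_ring_1) mpol \<Rightarrow> 'g \<Rightarrow> ('v, 'k) mpol set" where
  "socle_gen d f \<omega> = (THE u. u \<in> piece d (Ann f) \<omega> \<and> cls_act u f = 1)"

definition dual_basis ::
    "('v::finite \<Rightarrow> 'g::ab_group_add) \<Rightarrow> ('v, 'k::comm_ring_1) mpol \<Rightarrow> 'g \<Rightarrow> 'g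
      \<Rightarrow> ('v, 'k) mpol set list \<Rightarrow> ('v, 'k) mpol set list" where
  "dual_basis d f \<omega> h Cs = (THE Ds.
     is_basis (Ann f) (piece d (Ann f) (\<omega> - h)) Ds \<and> length Ds = length Cs \<and>
     (\<forall>i<length Cs. \<forall>j<length Cs.
        Ds ! i \<otimes>\<^bsub>quot_alg (Ann f)\<^esub> Cs ! j =
          (if i = j then socle_gen d f \<omega> else \<zero>\<^bsub>quot_alg (Ann f)\<^esub>)))"

definition mixed_hessian ::
    "('v::finite, 'k::comm_ring_1) mpol \<Rightarrow> ('v, 'k) mpol set list \<Rightarrow> ('v, 'k) mpol set list
      \<Rightarrow> ('v, 'k) mpol mat" where
  "mixed_hessian f Bs Cs = mat (length Bs) (length Cs)
     (\<lambda>(i, j). cls_act (Bs ! i \<otimes>\<^bsub>quot_alg (Ann f)\<^esub> Cs ! j) f)"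

definition coords ::
    "('v, 'k::comm_ring_1) mpol set \<Rightarrow> ('v, 'k) mpol set list \<Rightarrow> ('v, 'k) mpol set \<Rightarrow> 'k list" where
  "coords I Cs u = (THE cs. length cs = length Cs \<and>
     ring.combine (quot_alg I) (map (\<lambda>c. cls I (Const c)) cs) Cs = u)"

text \<open>Column \<open>j\<close> consists of the \<open>Cs\<close>-coordinates of the image of \<open>Bs ! j\<close>.\<close>

definition matrix_of ::
    "('v, 'k::comm_ring_1) mpol set \<Rightarrow> ('v, 'k) mpol set list \<Rightarrow> ('v, 'k) mpol set list
      \<Rightarrow> (('v, 'k) mpol set \<Rightarrow> ('v, 'k) mpol set) \<Rightarrow> 'k mat" where
  "matrix_of I Bs Cs T = mat_of_cols_list (length Cs) (map (\<lambda>b. coords I Cs (T b)) Bs)"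

end

theory Submission
  imports Defs
begin

text \<open>
  Write \<open>\<beta>\<^sub>j\<close> for the elements of the basis of \<open>A\<^sub>g\<close>, \<open>\<gamma>\<^sub>i\<close> for those of the basis of
  \<open>A\<^sub>h\<close> and \<open>\<delta>\<^sub>i\<close> for the basis of \<open>A\<^bsub>\<omega>-h\<^esub>\<close> dual to the latter. If
  \<open>\<beta>\<^sub>j L\<^sup>k = \<Sum>\<^sub>i c\<^sub>i \<gamma>\<^sub>i\<close>, then multiplying by \<open>\<delta>\<^sub>i\<close> and applying the result to \<open>f\<close> gives
  \<open>c\<^sub>i = L\<^sup>k(F)\<close>, where \<open>F = (\<delta>\<^sub>i \<beta>\<^sub>j)(f)\<close> is the entry of the Hessian and is homogeneous of
  degree \<open>h - g = k l\<close>. It remains to see that \<open>L\<^sup>k(F) = k! F(a)\<close>.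

  For this last identity (\<open>linear_form_power_act_homog\<close>) the multinomial theorem computes the
  constant term of \<open>L\<^sup>k(F)\<close> as \<open>k!\<close> times the value at \<open>a\<close> of the part of \<open>F\<close> of total degree
  \<open>k\<close>. Only monomials in variables of degree \<open>l\<close> survive at \<open>a\<close>; such a monomial of total
  degree \<open>n\<close> satisfies \<open>n l = k l\<close>, and \<open>\<phi>(l) = 1\<close> forces \<open>n = k\<close>.

  The dual basis and the socle generator are definite descriptions, so the argument also needs
  that they exist and are unique (\<open>socle_gen_cls\<close>, \<open>dual_basis_cls\<close>). Both follow from
  nondegeneracy of the pairing \<open>(\<alpha>, \<beta>) \<mapsto> (\<alpha>\<beta>)(f)\<close> between complementary degrees
  (\<open>apolarity_nondegenerate\<close>): a monomial \<open>x\<^sup>m\<close> occurring in \<open>\<alpha>(f)\<close> is detected by the operator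
  \<open>X\<^sup>m\<close>. Polynomials are handled throughout via their divided-power coefficients
  \<open>m! F\<^sub>m\<close>, on which the action of \<open>Q\<close> is by shifts of the exponent.
\<close>

section \<open>Divided-power coefficients\<close>

text \<open>The action of \<^term>\<open>Var i\<close> as \<open>\<partial>/\<partial>x\<^sub>i\<close> produces falling factorials. They disappear when
  polynomials are written in the basis of divided powers \<open>x\<^sup>m / m!\<close>, available in
  characteristic zero: the coefficient there is \<open>m!\<close> times the usual one, and differentiation
  only shifts the index.\<close>

definition mfact :: "('v::finite \<Rightarrow>\<^sub>0 nat) \<Rightarrow> 'k::field_char_0" where
  "mfact m = (\<Prod>i\<in>UNIV. fact (Poly_Mapping.lookup m i))"

definition dpc :: "('v::finite, 'k::field_char_0) mpol \<Rightarrow> ('v \<Rightarrow>\<^sub>0 nat) \<Rightarrow> 'k" where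
  "dpc F m = mfact m * Poly_Mapping.lookup F m"

lemma mfact_nonzero [simp]: "mfact m \<noteq> 0"
  by (simp add: mfact_def)

lemma mfact_zero [simp]: "mfact 0 = 1"
  by (simp add: mfact_def)

lemma dpc_at_zero: "dpc F 0 = Poly_Mapping.lookup F 0"
  by (simp add: dpc_def)

lemma mfact_add_single:
  "mfact (m + Poly_Mapping.single i 1) = of_nat (Suc (Poly_Mapping.lookup m i)) * mfact m"
proof -
  have "mfact (m + Poly_Mapping.single i 1) =
      fact (Suc (Poly_Mapping.lookup m i)) * (\<Prod>j\<in>UNIV - {i}. fact (Poly_Mapping.lookup m j))"
    unfolding mfact_def
    by (subst prod.remove[of _ i]) (auto simp: lookup_add lookup_single intro!: prod.cong)
  also have "\<dots> = of_nat (Suc (Poly_Mapping.lookup m i)) * mfact m"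
    unfolding mfact_def
    by (subst (2) prod.remove[of _ i]) (auto simp: algebra_simps)
  finally show ?thesis .
qed

lemma mpol_eqI_dpc: "(\<And>m. dpc F m = dpc H m) \<Longrightarrow> F = H"
  by (auto simp: dpc_def intro!: poly_mapping_eqI)

lemma dpc_nonzero_iff: "dpc F m \<noteq> 0 \<longleftrightarrow> m \<in> Poly_Mapping.keys F"
  by (simp add: dpc_def in_keys_iff)

lemma lookup_partial:
  "Poly_Mapping.lookup (partial i F) n =
     of_nat (Suc (Poly_Mapping.lookup n i)) * Poly_Mapping.lookup F (n + Poly_Mapping.single i 1)"
proof -
  let ?e = "Poly_Mapping.single i (1::nat)"
  have eq: "m - ?e = n \<longleftrightarrow> m = n + ?e" if "Poly_Mapping.lookup m i \<noteq> 0" for m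
    using that by (auto simp: poly_mapping_eq_iff fun_eq_iff lookup_add lookup_minus lookup_single when_def)
  have "Poly_Mapping.lookup (partial i F) n =
      (\<Sum>m\<in>Poly_Mapping.keys F. if m = n + ?e then
         of_nat (Poly_Mapping.lookup m i) * Poly_Mapping.lookup F m else 0)"
    unfolding partial_def lookup_sum
  proof (rule sum.cong[OF refl])
    fix m
    show "Poly_Mapping.lookup (Poly_Mapping.single (m - ?e)
            (of_nat (Poly_Mapping.lookup m i) * Poly_Mapping.lookup F m)) n =
          (if m = n + ?e then of_nat (Poly_Mapping.lookup m i) * Poly_Mapping.lookup F m else 0)"
      using eq[of m] by (cases "Poly_Mapping.lookup m i = 0") (auto simp: lookup_single when_def)
  qed
  then show ?thesis
    by (simp add: lookup_add in_keys_iff)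
qed

lemma dpc_partial: "dpc (partial i F) n = dpc F (n + Poly_Mapping.single i 1)"
  unfolding dpc_def lookup_partial mfact_add_single by (simp add: algebra_simps)

lemma dpc_partial_funpow: "dpc ((partial i ^^ k) F) n = dpc F (n + Poly_Mapping.single i k)"
  by (induction k arbitrary: n)
    (simp_all add: dpc_partial add.assoc single_add[symmetric])

lemma sum_single_lookup: "(\<Sum>i\<in>UNIV. Poly_Mapping.single i (Poly_Mapping.lookup m i)) = (m :: 'v::finite \<Rightarrow>\<^sub>0 nat)"
  by (rule poly_mapping_eqI) (simp add: lookup_sum lookup_single when_def)

text \<open>Shifts of the index commute, so the fold that defines \<^const>\<open>mon_diff\<close> is well-behaved and
  the shifts of the single variables add up.\<close>

lemma dpc_mon_diff:
  fixes F :: "('v::finite, 'k::field_char_0) mpol"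
  shows "dpc (mon_diff m F) n = dpc F (n + m)"
proof -
  interpret comp_fun_commute_on UNIV "\<lambda>i. partial i ^^ Poly_Mapping.lookup m i :: ('v, 'k) mpol \<Rightarrow> _"
    by unfold_locales
      (rule ext, rule mpol_eqI_dpc, simp add: dpc_partial_funpow add_ac)
  have "dpc (Finite_Set.fold (\<lambda>i. partial i ^^ Poly_Mapping.lookup m i) F A) n =
      dpc F (n + (\<Sum>i\<in>A. Poly_Mapping.single i (Poly_Mapping.lookup m i)))" for A
    using finite[of A]
  proof (induction A arbitrary: n)
    case (insert i A)
    then show ?case
      by (simp add: dpc_partial_funpow add.assoc)
  qed simp
  from this[of UNIV] show ?thesis
    by (simp add: mon_diff_def sum_single_lookup)
qed

section \<open>The module structure\<close>

lemma lookup_single_mult: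
  fixes P :: "('v, 'k::comm_ring_1) mpol"
  shows "Poly_Mapping.lookup (Poly_Mapping.single u c * P) (n + u) = c * Poly_Mapping.lookup P n"
    and "(\<And>q. m \<noteq> q + u) \<Longrightarrow> Poly_Mapping.lookup (Poly_Mapping.single u c * P) m = 0"
  by (simp_all add: lookup_mult lookup_single when_mult add.commute[of _ u])

lemma lookup_Const_mult [simp]: "Poly_Mapping.lookup (Const c * P) m = c * Poly_Mapping.lookup P m"
  for P :: "('v, 'k::comm_ring_1) mpol"
  using lookup_single_mult(1)[of 0 c P m] by (simp add: Const_def)

lemma dpc_add: "dpc (F + H) m = dpc F m + dpc H m"
  by (simp add: dpc_def lookup_add algebra_simps)

lemma dpc_Const_mult: "dpc (Const c * F) m = c * dpc F m"
  by (simp add: dpc_def)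

lemma dpc_sum: "dpc (sum F A) m = (\<Sum>x\<in>A. dpc (F x) m)"
  by (simp add: dpc_def lookup_sum sum_distrib_left)

lemma dpc_diff_act:
  "dpc (diff_act \<alpha> F) n = (\<Sum>m\<in>Poly_Mapping.keys \<alpha>. Poly_Mapping.lookup \<alpha> m * dpc F (n + m))"
  by (simp add: diff_act_def dpc_sum dpc_Const_mult dpc_mon_diff)

text \<open>Summing over any finite set of exponents containing the support makes it possible to compare
  the actions of several operators termwise.\<close>

lemma dpc_diff_act_superset:
  assumes "finite M" "Poly_Mapping.keys \<alpha> \<subseteq> M"
  shows "dpc (diff_act \<alpha> F) n = (\<Sum>m\<in>M. Poly_Mapping.lookup \<alpha> m * dpc F (n + m))"
  unfolding dpc_diff_act
  by (rule sum.mono_neutral_left) (use assms in \<open>auto simp: in_keys_iff\<close>)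

lemma diff_act_add:
  fixes F :: "('v::finite, 'k::field_char_0) mpol"
  shows "diff_act (\<alpha> + \<beta>) F = diff_act \<alpha> F + diff_act \<beta> F"
proof (rule mpol_eqI_dpc)
  fix n
  let ?M = "Poly_Mapping.keys \<alpha> \<union> Poly_Mapping.keys \<beta>"
  have "dpc (diff_act \<gamma> F) n = (\<Sum>m\<in>?M. Poly_Mapping.lookup \<gamma> m * dpc F (n + m))"
    if "\<gamma> \<in> {\<alpha>, \<beta>, \<alpha> + \<beta>}" for \<gamma>
    by (rule dpc_diff_act_superset) (use that Poly_Mapping.keys_add[of \<alpha> \<beta>] in auto)
  then show "dpc (diff_act (\<alpha> + \<beta>) F) n = dpc (diff_act \<alpha> F + diff_act \<beta> F) n"
    by (simp add: dpc_add lookup_add algebra_simps sum.distrib)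
qed

lemma diff_act_zero [simp]: "diff_act 0 F = 0"
  by (simp add: diff_act_def)

lemma diff_act_sum:
  fixes F :: "('v::finite, 'k::field_char_0) mpol"
  shows "diff_act (sum \<alpha> A) F = (\<Sum>x\<in>A. diff_act (\<alpha> x) F)"
  by (induction A rule: infinite_finite_induct) (auto simp: diff_act_add)

lemma diff_act_single: "dpc (diff_act (Poly_Mapping.single m c) F) n = c * dpc F (n + m)"
  by (simp add: dpc_diff_act)

lemma diff_act_right_sum:
  fixes \<alpha> :: "('v::finite, 'k::field_char_0) mpol"
  shows "diff_act \<alpha> (sum F A) = (\<Sum>x\<in>A. diff_act \<alpha> (F x))"
  by (rule mpol_eqI_dpc)
    (subst dpc_sum, simp add: dpc_diff_act dpc_sum sum_distrib_left sum.swap[of _ A])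

lemma mpol_sum_single: "(\<Sum>m\<in>Poly_Mapping.keys P. Poly_Mapping.single m (Poly_Mapping.lookup P m)) = P"
  for P :: "('v, 'k::comm_ring_1) mpol"
  by (rule poly_mapping_eqI) (simp add: lookup_sum lookup_single when_def in_keys_iff)

text \<open>Both sides are additive in both operators, and for two monomials the claim is that shifting by
  \<open>m'\<close> and then by \<open>m\<close> is shifting by \<open>m + m'\<close>.\<close>

lemma diff_act_mult:
  fixes F :: "('v::finite, 'k::field_char_0) mpol"
  shows "diff_act (\<alpha> * \<beta>) F = diff_act \<alpha> (diff_act \<beta> F)"
proof -
  let ?s = "\<lambda>P m. Poly_Mapping.single m (Poly_Mapping.lookup P m)"
  have mono: "diff_act (?s \<alpha> m * ?s \<beta> m') F = diff_act (?s \<alpha> m) (diff_act (?s \<beta> m') F)" for m m'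
    by (rule mpol_eqI_dpc) (simp add: mult_single diff_act_single add_ac)
  have "diff_act (\<alpha> * \<beta>) F =
      diff_act ((\<Sum>m\<in>Poly_Mapping.keys \<alpha>. ?s \<alpha> m) * (\<Sum>m\<in>Poly_Mapping.keys \<beta>. ?s \<beta> m)) F"
    by (simp add: mpol_sum_single)
  also have "\<dots> = (\<Sum>m\<in>Poly_Mapping.keys \<alpha>. \<Sum>m'\<in>Poly_Mapping.keys \<beta>. diff_act (?s \<alpha> m) (diff_act (?s \<beta> m') F))"
    by (simp only: sum_product diff_act_sum mono)
  also have "\<dots> = diff_act (\<Sum>m\<in>Poly_Mapping.keys \<alpha>. ?s \<alpha> m) (diff_act (\<Sum>m\<in>Poly_Mapping.keys \<beta>. ?s \<beta> m) F)"
    by (simp only: diff_act_sum diff_act_right_sum sum.swap[of _ "Poly_Mapping.keys \<alpha>"])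
  finally show ?thesis by (simp add: mpol_sum_single)
qed

lemma diff_act_Const:
  fixes F :: "('v::finite, 'k::field_char_0) mpol"
  shows "diff_act (Const c) F = Const c * F"
  by (rule mpol_eqI_dpc) (simp add: dpc_Const_mult, simp add: Const_def diff_act_single)

lemma diff_act_right_zero [simp]:
  fixes \<alpha> :: "('v::finite, 'k::field_char_0) mpol"
  shows "diff_act \<alpha> 0 = 0"
  by (rule mpol_eqI_dpc) (simp add: dpc_diff_act, simp add: dpc_def)

lemma diff_act_Const_mult:
  fixes F :: "('v::finite, 'k::field_char_0) mpol"
  shows "diff_act (Const c * \<alpha>) F = Const c * diff_act \<alpha> F"
  by (simp add: diff_act_mult diff_act_Const)

section \<open>The grading\<close>

lemma nat_mult_0 [simp]: "nat_mult 0 x = 0"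
  by (simp add: nat_mult_def)

lemma nat_mult_add: "nat_mult (m + n) x = nat_mult m x + nat_mult n x"
  by (induction n) (auto simp: nat_mult_def add_ac)

lemma mon_deg_0 [simp]: "mon_deg d 0 = 0"
  by (simp add: mon_deg_def)

lemma mon_deg_add: "mon_deg d (m + n) = mon_deg d m + mon_deg d n"
  by (simp add: mon_deg_def lookup_add nat_mult_add sum.distrib)

lemma homog_mult:
  assumes "\<alpha> \<in> homog d g" "\<beta> \<in> homog d h"
  shows "(\<alpha> * \<beta> :: ('v::finite, 'k::comm_ring_1) mpol) \<in> homog d (g + h)"
  using assms keys_mult[of \<alpha> \<beta>] by (force simp: homog_def mon_deg_add)

lemma homog_add:
  assumes "\<alpha> \<in> homog d g" "\<beta> \<in> homog d g"
  shows "(\<alpha> + \<beta> :: ('v::finite, 'k::comm_ring_1) mpol) \<in> homog d g"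
  using assms Poly_Mapping.keys_add[of \<alpha> \<beta>] by (force simp: homog_def)

lemma homog_0 [simp]: "0 \<in> homog d g"
  by (simp add: homog_def)

lemma homog_sum:
  "(\<And>i. i \<in> A \<Longrightarrow> \<alpha> i \<in> homog d g) \<Longrightarrow> (sum \<alpha> A :: ('v::finite, 'k::comm_ring_1) mpol) \<in> homog d g"
  by (induction A rule: infinite_finite_induct) (auto intro: homog_add)

lemma homog_Const_mult:
  "\<alpha> \<in> homog d g \<Longrightarrow> (Const c * \<alpha> :: ('v::finite, 'k::comm_ring_1) mpol) \<in> homog d g"
  by (auto simp: homog_def in_keys_iff)

lemma mon_deg_single: "mon_deg d (Poly_Mapping.single i 1) = d i"
proof -
  have "mon_deg d (Poly_Mapping.single i 1) = (\<Sum>j\<in>UNIV. if j = i then d i else 0)"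
    unfolding mon_deg_def by (rule sum.cong) (auto simp: lookup_single nat_mult_def)
  then show ?thesis by simp
qed

lemma homog_power: "\<alpha> \<in> homog d l \<Longrightarrow> \<alpha> ^ k \<in> homog d (nat_mult k l)"
  for \<alpha> :: "('v::finite, 'k::comm_ring_1) mpol"
proof (induction k)
  case 0
  then show ?case by (simp add: homog_def)
next
  case (Suc k)
  have "nat_mult (Suc k) l = l + nat_mult k l"
    by (simp add: nat_mult_def add.commute)
  with Suc homog_mult[of \<alpha> d l "\<alpha> ^ k"] show ?case by simp
qed

text \<open>A divided-power coefficient of the result at \<open>n\<close> is a combination of coefficients of
  \<open>F\<close> at \<open>n + m\<close> with \<open>m\<close> in the support of the operator, whence the difference of degrees.\<close>

lemma homog_diff_act:
  fixes d :: "'v::finite \<Rightarrow> 'g::ab_group_add" and F :: "('v, 'k::field_char_0) mpol"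
  assumes "\<alpha> \<in> homog d g" "F \<in> homog d h"
  shows "diff_act \<alpha> F \<in> homog d (h - g)"
  unfolding homog_def
proof (intro CollectI ballI)
  fix n assume "n \<in> Poly_Mapping.keys (diff_act \<alpha> F)"
  then have "dpc (diff_act \<alpha> F) n \<noteq> 0" by (simp add: dpc_nonzero_iff)
  then obtain m where "m \<in> Poly_Mapping.keys \<alpha>" "dpc F (n + m) \<noteq> 0"
    unfolding dpc_diff_act by (auto elim: sum.not_neutral_contains_not_neutral)
  then show "mon_deg d n = h - g"
    using assms by (auto simp: homog_def mon_deg_add dpc_nonzero_iff algebra_simps)
qed

lemma Const_lookup_of_homog_0:
  assumes "graded_poly_ring d TYPE('k)" "F \<in> (homog d 0 :: ('v::finite, 'k::comm_ring_1) mpol set)"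
  shows "F = Const (Poly_Mapping.lookup F 0)"
  using assms by (auto simp: graded_poly_ring_def Const_def)

section \<open>Powers of a linear form\<close>

definition total_deg :: "('v::finite \<Rightarrow>\<^sub>0 nat) \<Rightarrow> nat" where
  "total_deg m = (\<Sum>i\<in>UNIV. Poly_Mapping.lookup m i)"

definition mon_at :: "('v::finite \<Rightarrow> 'k::comm_semiring_1) \<Rightarrow> ('v \<Rightarrow>\<^sub>0 nat) \<Rightarrow> 'k" where
  "mon_at a m = (\<Prod>i\<in>UNIV. a i ^ Poly_Mapping.lookup m i)"

lemma total_deg_add_single: "total_deg (m + Poly_Mapping.single i 1) = Suc (total_deg m)"
  by (simp add: total_deg_def lookup_add sum.distrib lookup_single when_def)

lemma mon_at_add_single: "mon_at a (m + Poly_Mapping.single i 1) = a i * mon_at a m"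
  unfolding mon_at_def
  by (subst (1 2) prod.remove[of _ i])
    (auto simp: lookup_add lookup_single algebra_simps intro!: prod.cong)

text \<open>This is the multinomial theorem: the coefficient of \<open>X\<^sup>m\<close> in \<open>L\<^sup>k\<close> is
  \<open>(k!/m!) a\<^sup>m\<close>. Multiplying by \<open>m!\<close> clears the denominator, and the induction step then reduces
  to \<open>\<Sum>\<^sub>i m\<^sub>i = k + 1\<close>, as in Euler's formula for homogeneous polynomials.\<close>

lemma power_linear_form_coeff:
  fixes a :: "'v::finite \<Rightarrow> 'k::field_char_0"
  shows "dpc ((\<Sum>i\<in>UNIV. Const (a i) * Var i) ^ k) m =
           (if total_deg m = k then fact k * mon_at a m else 0)"
proof (induction k arbitrary: m)
  case 0
  have "total_deg m = 0 \<longleftrightarrow> m = 0"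
    by (auto simp: total_deg_def poly_mapping_eq_iff fun_eq_iff)
  then show ?case
    by (auto simp: dpc_def lookup_one mon_at_def mfact_def when_def)
next
  case (Suc k)
  let ?L = "\<Sum>i\<in>UNIV. Const (a i) * Var i"
  have monomial: "dpc (Const (a i) * Var i * ?L ^ k) m =
      (if total_deg m = Suc k then of_nat (Poly_Mapping.lookup m i) * (fact k * mon_at a m) else 0)" for i
  proof (cases "Poly_Mapping.lookup m i = 0")
    case True
    then have "m \<noteq> q + Poly_Mapping.single i 1" for q
      by (auto simp: lookup_add)
    then show ?thesis
      using True by (simp add: dpc_def Var_def mult.assoc lookup_single_mult(2))
  next
    case False
    define q where "q = m - Poly_Mapping.single i 1"
    have m: "m = q + Poly_Mapping.single i 1"
      using False by (auto simp: q_def poly_mapping_eq_iff fun_eq_iff lookup_add lookup_minus lookup_single when_def)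
    have "dpc (Const (a i) * Var i * ?L ^ k) m =
        of_nat (Poly_Mapping.lookup m i) * a i * dpc (?L ^ k) q"
      unfolding m dpc_def mfact_add_single Var_def mult.assoc lookup_Const_mult lookup_single_mult(1)
      by (simp add: lookup_add algebra_simps)
    also have "\<dots> = (if total_deg m = Suc k then of_nat (Poly_Mapping.lookup m i) * (fact k * mon_at a m) else 0)"
      unfolding Suc.IH m total_deg_add_single mon_at_add_single by simp
    finally show ?thesis .
  qed
  have "dpc (?L ^ Suc k) m = (\<Sum>i\<in>UNIV. dpc (Const (a i) * Var i * ?L ^ k) m)"
    by (simp add: sum_distrib_right dpc_sum)
  also have "\<dots> = (if total_deg m = Suc k
      then (\<Sum>i\<in>UNIV. of_nat (Poly_Mapping.lookup m i)) * (fact k * mon_at a m) else 0)"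
    unfolding monomial by (simp add: sum_distrib_right)
  also have "(\<Sum>i\<in>UNIV. of_nat (Poly_Mapping.lookup m i)) = (of_nat (total_deg m) :: 'k)"
    by (simp add: total_deg_def)
  finally show ?case by simp
qed

text \<open>The constant term of \<open>L\<^sup>k(F)\<close> pairs the coefficients of \<open>L\<^sup>k\<close> with the divided-power
  coefficients of \<open>F\<close>. Moving the factor \<open>m!\<close> from \<open>F\<close> to \<open>L\<^sup>k\<close> leaves
  \<open>k! \<Sum> F\<^sub>m a\<^sup>m\<close> over the \<open>m\<close> of total degree \<open>k\<close>. This is \<open>k! F(a)\<close> as soon as monomials of other
  total degrees vanish at \<open>a\<close>.\<close>

lemma linear_form_power_act:
  fixes a :: "'v::finite \<Rightarrow> 'k::field_char_0"
  assumes pure: "\<And>m. m \<in> Poly_Mapping.keys F \<Longrightarrow> mon_at a m \<noteq> 0 \<Longrightarrow> total_deg m = k"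
  shows "Poly_Mapping.lookup (diff_act ((\<Sum>i\<in>UNIV. Const (a i) * Var i) ^ k) F) 0 = fact k * eval_at a F"
proof -
  let ?P = "(\<Sum>i\<in>UNIV. Const (a i) * Var i) ^ k"
  let ?M = "Poly_Mapping.keys ?P \<union> Poly_Mapping.keys F"
  have "Poly_Mapping.lookup (diff_act ?P F) 0 =
      (\<Sum>m\<in>?M. Poly_Mapping.lookup ?P m * dpc F m)"
    using dpc_diff_act_superset[of ?M ?P F 0] by (simp add: dpc_at_zero)
  also have "\<dots> = (\<Sum>m\<in>?M. Poly_Mapping.lookup F m * dpc ?P m)"
    by (simp add: dpc_def algebra_simps)
  also have "\<dots> = (\<Sum>m\<in>Poly_Mapping.keys F. Poly_Mapping.lookup F m * dpc ?P m)"
    by (rule sum.mono_neutral_right) (auto simp: in_keys_iff)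
  also have "\<dots> = (\<Sum>m\<in>Poly_Mapping.keys F. Poly_Mapping.lookup F m * (fact k * mon_at a m))"
    by (rule sum.cong[OF refl]) (use pure in \<open>auto simp: power_linear_form_coeff\<close>)
  also have "\<dots> = fact k * eval_at a F"
    by (simp add: eval_at_def mon_at_def sum_distrib_left algebra_simps)
  finally show ?thesis .
qed

lemma additive_nat_mult:
  assumes "Modules.additive \<phi>"
  shows "\<phi> (nat_mult n x) = of_nat n * (\<phi> x :: rat)"
  using assms by (induction n) (auto simp: nat_mult_def Modules.additive_def additive.zero algebra_simps)

text \<open>Applying \<open>\<phi>\<close> to \<open>n l = k l\<close> gives \<open>n = k\<close>, which is not automatic in a group with
  torsion. This is where \<open>\<phi>\<close>-linearity enters.\<close>

lemma total_deg_of_support: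
  assumes "Modules.additive \<phi>" "\<phi> l = (1::rat)"
    and "mon_deg d m = nat_mult k l" and supp: "\<And>i. Poly_Mapping.lookup m i \<noteq> 0 \<Longrightarrow> d i = l"
  shows "total_deg m = k"
proof -
  interpret Modules.additive \<phi> by fact
  have "of_nat k = \<phi> (mon_deg d m)"
    using assms by (simp add: additive_nat_mult)
  also have "\<dots> = (\<Sum>i\<in>UNIV. of_nat (Poly_Mapping.lookup m i) * \<phi> (d i))"
    by (simp add: mon_deg_def sum additive_nat_mult[OF assms(1)])
  also have "\<dots> = (\<Sum>i\<in>UNIV. of_nat (Poly_Mapping.lookup m i))"
    using supp assms(2) by (intro sum.cong) auto
  finally show ?thesis
    by (simp add: total_deg_def flip: of_nat_sum)
qed

text \<open>A monomial involving a variable of degree other than \<open>l\<close> vanishes at the point; every other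
  monomial of \<open>F\<close> has total degree \<open>k\<close>.\<close>

lemma linear_form_power_act_homog:
  fixes a :: "'v::finite \<Rightarrow> 'k::field_char_0"
  assumes "Modules.additive \<phi>" "\<phi> l = (1::rat)" "F \<in> homog d (nat_mult k l)"
  shows "Poly_Mapping.lookup (diff_act ((\<Sum>i | d i = l. Const (a i) * Var i) ^ k) F) 0 =
           fact k * eval_at (\<lambda>i. if d i = l then a i else 0) F"
proof -
  let ?a = "\<lambda>i. if d i = l then a i else 0"
  have L: "(\<Sum>i | d i = l. Const (a i) * Var i) = (\<Sum>i\<in>UNIV. Const (?a i) * Var i)"
    by (rule sum.mono_neutral_cong_left) (auto simp: Const_def)
  show ?thesis
    unfolding L
  proof (rule linear_form_power_act)
    fix m assume m: "m \<in> Poly_Mapping.keys F" "mon_at ?a m \<noteq> 0"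
    show "total_deg m = k"
      by (rule total_deg_of_support[OF assms(1,2)])
        (use m assms(3) in \<open>force simp: homog_def mon_at_def split: if_splits\<close>)+
  qed
qed

section \<open>Dual families of linear functionals\<close>

text \<open>Finitely many linearly independent functionals on \<open>W\<close> admit a dual family of vectors. The
  induction is Gram-Schmidt-like: given dual vectors \<open>w\<^sub>i\<close> for \<open>e\<^sub>i\<close>, \<open>i \<in> J\<close>, the functional
  \<open>r = e\<^sub>n - \<Sum>\<^sub>i e\<^sub>n(w\<^sub>i) e\<^sub>i\<close> is nonzero by independence. Correcting a vector \<open>x\<close> with
  \<open>r(x) \<noteq> 0\<close> by the \<open>w\<^sub>i\<close> gives a vector killed by all \<open>e\<^sub>i\<close> on which \<open>e\<^sub>n\<close> takes the value
  \<open>r(x)\<close>.\<close>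

lemma (in vector_space) dual_family:
  assumes "finite J" "subspace W"
    and add: "\<And>j x y. x \<in> W \<Longrightarrow> y \<in> W \<Longrightarrow> e j (x + y) = e j x + e j y"
    and scale: "\<And>j c x. x \<in> W \<Longrightarrow> e j (scale c x) = c * e j x"
    and indep: "\<And>c. (\<And>x. x \<in> W \<Longrightarrow> (\<Sum>j\<in>J. c j * e j x) = 0) \<Longrightarrow> \<forall>j\<in>J. c j = 0"
  shows "\<exists>w. (\<forall>i\<in>J. w i \<in> W) \<and> (\<forall>i\<in>J. \<forall>j\<in>J. e j (w i) = (if i = j then 1 else 0))"
  using assms(1) indep
proof (induction J rule: finite_induct)
  case empty
  then show ?case by simp
next
  case (insert n J)
  have sum: "e j (\<Sum>i\<in>J. scale (c i) (w i)) = (\<Sum>i\<in>J. c i * e j (w i))"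
    if "\<And>i. i \<in> J \<Longrightarrow> w i \<in> W" for j c w
    using \<open>finite J\<close> that
  proof (induction J rule: finite_induct)
    case empty
    show ?case using scale[of 0 j 0] subspace_0[OF \<open>subspace W\<close>] by simp
  next
    case (insert i J)
    then show ?case
      using \<open>subspace W\<close> by (simp add: add scale subspace_scale subspace_sum)
  qed
  have "\<forall>j\<in>J. c j = 0" if c: "\<And>x. x \<in> W \<Longrightarrow> (\<Sum>j\<in>J. c j * e j x) = 0" for c
  proof -
    have "\<forall>j\<in>insert n J. (c(n := 0)) j = 0"
    proof (rule insert.prems)
      fix x assume "x \<in> W"
      have "(\<Sum>j\<in>J. (c(n := 0)) j * e j x) = (\<Sum>j\<in>J. c j * e j x)"
        using insert.hyps by (intro sum.cong) auto
      then show "(\<Sum>j\<in>insert n J. (c(n := 0)) j * e j x) = 0"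
        using insert.hyps c[OF \<open>x \<in> W\<close>] by simp
    qed
    then show ?thesis using insert.hyps by (metis fun_upd_other insertCI)
  qed
  from insert.IH[OF this] obtain w where w: "\<And>i. i \<in> J \<Longrightarrow> w i \<in> W"
    "\<And>i j. i \<in> J \<Longrightarrow> j \<in> J \<Longrightarrow> e j (w i) = (if i = j then 1 else 0)"
    by blast
  \<comment> \<open>\<open>e\<^sub>n\<close> reduced by the other functionals, using their dual vectors.\<close>
  define r where "r x = e n x - (\<Sum>i\<in>J. e n (w i) * e i x)" for x
  obtain x where x: "x \<in> W" "r x \<noteq> 0"
  proof (rule ccontr)
    assume "\<not> thesis"
    with that have r0: "r x = 0" if "x \<in> W" for x
      using \<open>x \<in> W\<close> by blast
    let ?c = "\<lambda>j. if j = n then 1 else - e n (w j)"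
    have "\<forall>j\<in>insert n J. ?c j = 0"
    proof (rule insert.prems)
      fix x assume "x \<in> W"
      have "(\<Sum>j\<in>J. ?c j * e j x) = - (\<Sum>j\<in>J. e n (w j) * e j x)"
        unfolding sum_negf[symmetric] using insert.hyps by (intro sum.cong) auto
      then show "(\<Sum>j\<in>insert n J. ?c j * e j x) = 0"
        using r0[OF \<open>x \<in> W\<close>] insert.hyps by (simp add: r_def)
    qed
    then show False by simp
  qed
  define y where "y = x + (\<Sum>i\<in>J. scale (- e i x) (w i))"
  have yW: "y \<in> W"
    unfolding y_def using x w \<open>subspace W\<close> by (intro subspace_add subspace_sum subspace_scale)
  have e_y: "e j y = e j x - (\<Sum>i\<in>J. e i x * e j (w i))" for j
  proof -
    have "e j y = e j x + e j (\<Sum>i\<in>J. scale (- e i x) (w i))"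
      unfolding y_def using x w \<open>subspace W\<close>
      by (intro add subspace_sum subspace_scale)
    also have "e j (\<Sum>i\<in>J. scale (- e i x) (w i)) = (\<Sum>i\<in>J. - e i x * e j (w i))"
      by (rule sum[OF w(1)])
    finally show ?thesis
      by (simp add: sum_negf)
  qed
  have y0: "e j y = 0" if "j \<in> J" for j
  proof -
    have "(\<Sum>i\<in>J. e i x * e j (w i)) = (\<Sum>i\<in>J. if i = j then e i x else 0)"
      using that by (intro sum.cong) (auto simp: w(2))
    then show ?thesis
      using that insert.hyps by (simp add: e_y)
  qed
  have yn: "e n y = r x"
    by (simp add: e_y r_def mult.commute)
  define z where "z = scale (1 / r x) y"
  have z: "z \<in> W" "e n z = 1" "\<And>j. j \<in> J \<Longrightarrow> e j z = 0"
    using yW y0 yn x \<open>subspace W\<close> by (auto simp: z_def subspace_scale scale)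
  \<comment> \<open>With \<open>z\<close> dual to \<open>e\<^sub>n\<close>, subtracting multiples of it makes the old vectors vanish under \<open>e\<^sub>n\<close>.\<close>
  define v where "v i = (if i = n then z else w i + scale (- e n (w i)) z)" for i
  have "v i \<in> W" if "i \<in> insert n J" for i
    using that z w \<open>subspace W\<close> by (auto simp: v_def intro!: subspace_diff subspace_scale)
  moreover have "e j (v i) = (if i = j then 1 else 0)" if ij: "i \<in> insert n J" "j \<in> insert n J" for i j
  proof (cases "i = n")
    case True
    then show ?thesis using ij z by (auto simp: v_def)
  next
    case False
    then have "e j (v i) = e j (w i + scale (- e n (w i)) z)"
      by (simp add: v_def)
    also have "\<dots> = e j (w i) + e j (scale (- e n (w i)) z)"
      using ij False w(1) z(1) \<open>subspace W\<close> by (intro add subspace_scale) auto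
    also have "\<dots> = e j (w i) - e n (w i) * e j z"
      unfolding scale[OF z(1)] by simp
    finally have "e j (v i) = e j (w i) - e n (w i) * e j z" .
    then show ?thesis
      using ij False w z insert.hyps by auto
  qed
  ultimately show ?case by blast
qed

interpretation mpol: vector_space "\<lambda>c (F :: ('v, 'k::field) mpol). Const c * F"
  by unfold_locales (auto simp: algebra_simps Const_def single_add mult_single simp flip: mult.assoc)

section \<open>Quotients of the polynomial ring\<close>

lemma type_algebra_simps [simp]:
  "carrier ring_of_type_algebra = (UNIV :: 'a::ring_1 set)"
  "x \<oplus>\<^bsub>ring_of_type_algebra\<^esub> y = x + y" "x \<otimes>\<^bsub>ring_of_type_algebra\<^esub> y = x * y"
  "\<zero>\<^bsub>ring_of_type_algebra\<^esub> = (0::'a)" "\<one>\<^bsub>ring_of_type_algebra\<^esub> = (1::'a)"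
  by (simp_all add: ring_of_type_algebra_def)

lemma type_algebra_minus:
  "\<ominus>\<^bsub>ring_of_type_algebra\<^esub> x = - x" "x \<ominus>\<^bsub>ring_of_type_algebra\<^esub> y = x - y" for x y :: "'a::comm_ring_1"
proof -
  interpret cring "ring_of_type_algebra :: 'a ring" by (rule cring_from_type_algebra)
  show *: "\<ominus>\<^bsub>ring_of_type_algebra\<^esub> x = - x" for x :: 'a
    by (rule minus_equality) simp_all
  show "x \<ominus>\<^bsub>ring_of_type_algebra\<^esub> y = x - y"
    by (simp add: a_minus_def *)
qed

text \<open>Computations in \<open>Q/I\<close> are moved to representatives. Properness of \<open>I\<close> makes
  \<open>\<K> \<rightarrow> Q/I\<close> injective, so that the image of \<open>\<K>\<close> is a subfield and linear algebra over that
  subfield amounts to linear algebra over \<open>\<K>\<close> modulo \<open>I\<close>.\<close>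

locale proper_mpol_ideal =
  fixes I :: "('v::finite, 'k::field) mpol set"
  assumes ideal: "ideal I polyQ" and proper: "1 \<notin> I"
begin

sublocale Q: cring "polyQ :: ('v, 'k) mpol ring"
  by (rule cring_from_type_algebra)

sublocale I: ideal I polyQ
  by (rule ideal)

sublocale A: cring "quot_alg I"
  by (rule I.quotient_is_cring) (rule Q.is_cring)

sublocale pr: ring_hom_cring polyQ "quot_alg I" "cls I"
  by (rule I.rcos_ring_hom_cring) (rule Q.is_cring)

lemma cls_add: "cls I \<alpha> \<oplus>\<^bsub>quot_alg I\<^esub> cls I \<beta> = cls I (\<alpha> + \<beta>)"
  using pr.hom_add[of \<alpha> \<beta>] by simp

lemma cls_mult: "cls I \<alpha> \<otimes>\<^bsub>quot_alg I\<^esub> cls I \<beta> = cls I (\<alpha> * \<beta>)"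
  using pr.hom_mult[of \<alpha> \<beta>] by simp

lemma cls_zero: "\<zero>\<^bsub>quot_alg I\<^esub> = cls I 0"
  using pr.hom_zero by simp

lemma cls_one: "\<one>\<^bsub>quot_alg I\<^esub> = cls I 1"
  using pr.hom_one by simp

lemma cls_pow: "cls I \<alpha> [^]\<^bsub>quot_alg I\<^esub> (k::nat) = cls I (\<alpha> ^ k)"
  by (induction k) (simp_all add: cls_one cls_mult mult.commute)

lemma cls_carrier: "cls I \<alpha> \<in> carrier (quot_alg I)"
  using pr.hom_closed[of \<alpha>] by simp

lemma cls_eq_iff: "cls I \<alpha> = cls I \<beta> \<longleftrightarrow> \<alpha> - \<beta> \<in> I"
  using Q.quotient_eq_iff_same_a_r_cos[OF ideal, of \<alpha> \<beta>] by (simp add: type_algebra_minus)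

lemma Const_inverse: "c \<noteq> 0 \<Longrightarrow> Const (inverse c) * Const c = (1 :: ('v, 'k) mpol)"
  by (simp add: Const_def mult_single)

lemma Const_in_ideal_iff: "Const c \<in> I \<longleftrightarrow> c = 0"
proof
  show "c = 0" if "Const c \<in> I"
  proof (rule ccontr)
    assume "c \<noteq> 0"
    then show False
      using I.I_l_closed[OF that, of "Const (inverse c)"] proper by (simp add: Const_inverse)
  qed
  show "Const c \<in> I" if "c = 0"
    using that I.zero_closed by (simp add: Const_def)
qed

lemma subfield_scalars: "subfield (scalars I) (quot_alg I)"
proof -
  have hom: "ring_hom_ring (ring_of_type_algebra :: 'k ring) (quot_alg I) (\<lambda>c. cls I (Const c))"
  proof (rule ring_hom_ringI2[OF ring_from_type_algebra A.ring_axioms], rule ring_hom_memI)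
    fix x y :: 'k
    have "Const (x * y) = (Const x * Const y :: ('v, 'k) mpol)"
      "Const (x + y) = (Const x + Const y :: ('v, 'k) mpol)"
      by (simp_all add: Const_def mult_single single_add)
    then show "cls I (Const (x \<otimes>\<^bsub>ring_of_type_algebra\<^esub> y)) =
        cls I (Const x) \<otimes>\<^bsub>quot_alg I\<^esub> cls I (Const y)"
      "cls I (Const (x \<oplus>\<^bsub>ring_of_type_algebra\<^esub> y)) =
        cls I (Const x) \<oplus>\<^bsub>quot_alg I\<^esub> cls I (Const y)"
      by (simp_all only: cls_add cls_mult type_algebra_simps)
  next
    have "Const 1 = (1 :: ('v, 'k) mpol)"
      by (simp add: Const_def)
    then show "cls I (Const \<one>\<^bsub>ring_of_type_algebra\<^esub>) = \<one>\<^bsub>quot_alg I\<^esub>"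
      by (simp only: cls_one type_algebra_simps)
  qed (rule cls_carrier)
  have ne: "\<one>\<^bsub>quot_alg I\<^esub> \<noteq> \<zero>\<^bsub>quot_alg I\<^esub>"
    using proper by (simp add: cls_one cls_zero cls_eq_iff)
  have "subfield (carrier ring_of_type_algebra) (ring_of_type_algebra :: 'k ring)"
    by (rule field.carrier_is_subfield[OF field_from_type_algebra])
  then have "subfield (UNIV :: 'k set) ring_of_type_algebra"
    by simp
  from ring_hom_ring.img_is_subfield(2)[OF hom this ne]
  have "subfield (range (\<lambda>c. cls I (Const c))) (quot_alg I)" .
  moreover have "scalars I = range (\<lambda>c. cls I (Const c))"
    unfolding scalars_def by blast
  ultimately show ?thesis by simp
qed

lemma combine_cls:
  "A.combine (map (\<lambda>i. cls I (Const (c i))) [0..<length \<beta>s]) (map (cls I) \<beta>s) =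
     cls I (\<Sum>i<length \<beta>s. Const (c i) * \<beta>s ! i)"
proof (induction \<beta>s arbitrary: c)
  case Nil
  then show ?case by (simp add: cls_zero)
next
  case (Cons \<beta> \<beta>s)
  have upt: "[0..<Suc (length \<beta>s)] = 0 # map Suc [0..<length \<beta>s]"
    by (simp add: map_Suc_upt upt_conv_Cons del: upt_Suc)
  show ?case
    using Cons.IH[of "c \<circ> Suc"]
    by (simp add: upt cls_add cls_mult sum.lessThan_Suc_shift comp_def del: upt_Suc sum.lessThan_Suc)
qed

lemma scalars_listE:
  assumes "set Ks \<subseteq> scalars I" "length Ks = n"
  obtains c where "Ks = map (\<lambda>i. cls I (Const (c i))) [0..<n]"
proof -
  have "\<forall>i<n. \<exists>c. Ks ! i = cls I (Const c)"
    using assms nth_mem[of _ Ks] by (fastforce simp: scalars_def)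
  then obtain c where "\<forall>i<n. Ks ! i = cls I (Const (c i))" by metis
  then have "Ks = map (\<lambda>i. cls I (Const (c i))) [0..<n]"
    using assms(2) by (auto intro: nth_equalityI)
  then show ?thesis by (rule that)
qed

lemma scalars_list: "set (map (\<lambda>i. cls I (Const (c i))) [0..<n]) \<subseteq> scalars I"
  by (auto simp: scalars_def)

lemma Span_cls:
  "A.Span (scalars I) (map (cls I) \<beta>s) = {cls I (\<Sum>i<length \<beta>s. Const (c i) * \<beta>s ! i) | c. True}"
proof -
  have sub: "set (map (cls I) \<beta>s) \<subseteq> carrier (quot_alg I)"
    by (auto simp: cls_carrier)
  show ?thesis
    unfolding A.Span_eq_combine_set_length_version[OF subfield_scalars sub]
  proof (intro equalityI subsetI; elim CollectE exE conjE; intro CollectI)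
    fix u Ks assume u: "u = A.combine Ks (map (cls I) \<beta>s)"
      and Ks: "length Ks = length (map (cls I) \<beta>s)" "set Ks \<subseteq> scalars I"
    from Ks(1) have "length Ks = length \<beta>s" by simp
    then obtain c where "Ks = map (\<lambda>i. cls I (Const (c i))) [0..<length \<beta>s]"
      using scalars_listE[OF Ks(2)] by metis
    then have "u = cls I (\<Sum>i<length \<beta>s. Const (c i) * \<beta>s ! i)"
      by (simp only: u combine_cls)
    then show "\<exists>c. u = cls I (\<Sum>i<length \<beta>s. Const (c i) * \<beta>s ! i) \<and> True"
      by blast
  next
    fix u c assume "u = cls I (\<Sum>i<length \<beta>s. Const (c i) * \<beta>s ! i)"
    then show "\<exists>Ks. u = A.combine Ks (map (cls I) \<beta>s) \<and>
      length Ks = length (map (cls I) \<beta>s) \<and> set Ks \<subseteq> scalars I"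
      by (intro exI[of _ "map (\<lambda>i. cls I (Const (c i))) [0..<length \<beta>s]"] conjI scalars_list)
        (simp_all only: combine_cls length_map length_upt diff_zero)
  qed
qed

lemma independent_cls_iff:
  "A.independent (scalars I) (map (cls I) \<beta>s) \<longleftrightarrow>
     (\<forall>c. (\<Sum>i<length \<beta>s. Const (c i) * \<beta>s ! i) \<in> I \<longrightarrow> (\<forall>i<length \<beta>s. c i = 0))"
    (is "_ \<longleftrightarrow> ?indep")
proof
  have sub: "set (map (cls I) \<beta>s) \<subseteq> carrier (quot_alg I)"
    by (auto simp: cls_carrier)
  have zero_iff: "cls I \<alpha> = \<zero>\<^bsub>quot_alg I\<^esub> \<longleftrightarrow> \<alpha> \<in> I" for \<alpha>
    by (simp add: cls_zero cls_eq_iff)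
  show ?indep if ind: "A.independent (scalars I) (map (cls I) \<beta>s)"
  proof (intro allI impI)
    fix c i assume c: "(\<Sum>i<length \<beta>s. Const (c i) * \<beta>s ! i) \<in> I" and i: "i < length \<beta>s"
    let ?Ks = "map (\<lambda>i. cls I (Const (c i))) [0..<length \<beta>s]"
    have "set (take (length (map (cls I) \<beta>s)) ?Ks) \<subseteq> {\<zero>\<^bsub>quot_alg I\<^esub>}"
      by (rule A.independent_imp_trivial_combine[OF subfield_scalars ind scalars_list])
        (simp only: combine_cls zero_iff c)
    moreover have "cls I (Const (c i)) \<in> set (take (length (map (cls I) \<beta>s)) ?Ks)"
      using i by simp
    ultimately have "cls I (Const (c i)) = \<zero>\<^bsub>quot_alg I\<^esub>"
      by blast
    then show "c i = 0"
      by (simp add: zero_iff Const_in_ideal_iff)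
  qed
  show "A.independent (scalars I) (map (cls I) \<beta>s)" if indep: ?indep
  proof (rule ccontr)
    assume dep: "\<not> A.independent (scalars I) (map (cls I) \<beta>s)"
    then obtain Ks where Ks: "length Ks = length (map (cls I) \<beta>s)" "set Ks \<subseteq> scalars I"
      "A.combine Ks (map (cls I) \<beta>s) = \<zero>\<^bsub>quot_alg I\<^esub>" "set Ks \<noteq> {\<zero>\<^bsub>quot_alg I\<^esub>}"
      using A.dependent_imp_non_trivial_combine[OF subfield_scalars sub] by metis
    from Ks(1) have len: "length Ks = length \<beta>s" by simp
    obtain c where c: "Ks = map (\<lambda>i. cls I (Const (c i))) [0..<length \<beta>s]"
      using scalars_listE[OF Ks(2) len] by metis
    have "\<forall>i<length \<beta>s. c i = 0"
      using indep Ks(3) unfolding c combine_cls zero_iff by blast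
    then have "set Ks \<subseteq> {\<zero>\<^bsub>quot_alg I\<^esub>}"
      unfolding c by (simp add: image_subset_iff zero_iff Const_in_ideal_iff)
    then have "Ks = []"
      using Ks(4) subset_singletonD by (metis set_empty)
    then show False
      using len dep by (metis A.li_Nil length_0_conv list.simps(8))
  qed
qed

text \<open>Independence is what makes the definite description in \<^const>\<open>coords\<close> refer to the
  coefficients at hand.\<close>

lemma coords_cls:
  assumes "A.independent (scalars I) (map (cls I) \<gamma>s)"
  shows "coords I (map (cls I) \<gamma>s) (cls I (\<Sum>i<length \<gamma>s. Const (c i) * \<gamma>s ! i)) =
           map c [0..<length \<gamma>s]"
  unfolding coords_def
proof (rule the_equality)
  show "length (map c [0..<length \<gamma>s]) = length (map (cls I) \<gamma>s) \<and>
    A.combine (map (\<lambda>c. cls I (Const c)) (map c [0..<length \<gamma>s])) (map (cls I) \<gamma>s) =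
      cls I (\<Sum>i<length \<gamma>s. Const (c i) * \<gamma>s ! i)"
    by (simp only: map_map comp_def combine_cls length_map length_upt diff_zero)
next
  fix cs
  assume cs: "length cs = length (map (cls I) \<gamma>s) \<and>
    A.combine (map (\<lambda>c. cls I (Const c)) cs) (map (cls I) \<gamma>s) =
      cls I (\<Sum>i<length \<gamma>s. Const (c i) * \<gamma>s ! i)"
  then have len: "length cs = length \<gamma>s" by simp
  then have "map (\<lambda>c. cls I (Const c)) cs = map (\<lambda>i. cls I (Const (cs ! i))) [0..<length \<gamma>s]"
    by (auto intro: nth_equalityI)
  with cs have "cls I (\<Sum>i<length \<gamma>s. Const (cs ! i) * \<gamma>s ! i) = cls I (\<Sum>i<length \<gamma>s. Const (c i) * \<gamma>s ! i)"
    by (simp only: combine_cls)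
  then have "(\<Sum>i<length \<gamma>s. Const (cs ! i - c i) * \<gamma>s ! i) \<in> I"
    by (simp add: cls_eq_iff Const_def single_diff left_diff_distrib sum_subtractf)
  with assms have "\<forall>i<length \<gamma>s. cs ! i - c i = 0"
    unfolding independent_cls_iff by meson
  then show "cs = map c [0..<length \<gamma>s]"
    using len by (auto intro: nth_equalityI)
qed

end

section \<open>The apolarity pairing\<close>

text \<open>For \<open>\<alpha>\<close> of degree \<open>deg f\<close> the polynomial \<open>\<alpha>(f)\<close> is a constant, and this functional is its
  value. The bilinear form \<open>(\<alpha>, \<beta>) \<mapsto> (\<alpha>\<beta>)(f)\<close> between
  complementary degrees is, modulo the annihilator, the perfect pairing that defines dual bases.\<close>

definition const_act :: "('v::finite, 'k::field_char_0) mpol \<Rightarrow> ('v, 'k) mpol \<Rightarrow> 'k" where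
  "const_act f \<alpha> = Poly_Mapping.lookup (diff_act \<alpha> f) 0"

lemma const_act_add: "const_act f (\<alpha> + \<beta>) = const_act f \<alpha> + const_act f \<beta>"
  by (simp add: const_act_def diff_act_add lookup_add)

lemma const_act_Const_mult: "const_act f (Const c * \<alpha>) = c * const_act f \<alpha>"
  by (simp add: const_act_def diff_act_Const_mult)

lemma const_act_zero [simp]: "const_act f 0 = 0"
  by (simp add: const_act_def)

lemma const_act_sum: "const_act f (sum \<alpha> A) = (\<Sum>x\<in>A. const_act f (\<alpha> x))"
  by (induction A rule: infinite_finite_induct) (auto simp: const_act_add)

lemma const_act_lincomb:
  "const_act f (\<beta> * (\<Sum>i\<in>A. Const (c i) * \<gamma> i)) = (\<Sum>i\<in>A. c i * const_act f (\<beta> * \<gamma> i))"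
  by (simp add: sum_distrib_left const_act_sum const_act_Const_mult mult.left_commute[of \<beta>])

lemma const_act_Ann: "\<alpha> \<in> Ann f \<Longrightarrow> const_act f \<alpha> = 0"
  by (simp add: const_act_def Ann_def)

lemma Ann_mult: "\<alpha> \<in> Ann f \<Longrightarrow> \<beta> * \<alpha> \<in> Ann f" for f :: "('v::finite, 'k::field_char_0) mpol"
  by (simp add: Ann_def diff_act_mult)

lemma Ann_add: "\<alpha> \<in> Ann f \<Longrightarrow> \<beta> \<in> Ann f \<Longrightarrow> \<alpha> + \<beta> \<in> Ann f" for f :: "('v::finite, 'k::field_char_0) mpol"
  by (simp add: Ann_def diff_act_add)

lemma diff_act_one [simp]: "diff_act 1 f = f" for f :: "('v::finite, 'k::field_char_0) mpol"
  using diff_act_Const[of 1 f] by (simp add: Const_def)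

lemma diff_act_minus: "diff_act (\<alpha> - \<beta>) f = diff_act \<alpha> f - diff_act \<beta> f" for f :: "('v::finite, 'k::field_char_0) mpol"
  using diff_act_add[of "\<alpha> - \<beta>" \<beta> f] by (simp add: algebra_simps)

lemma ideal_Ann: "ideal (Ann f) (polyQ :: ('v::finite, 'k::field_char_0) mpol ring)"
proof (rule idealI)
  interpret Q: cring "polyQ :: ('v, 'k) mpol ring"
    by (rule cring_from_type_algebra)
  show "ring (polyQ :: ('v, 'k) mpol ring)"
    by (rule Q.ring_axioms)
  show "subgroup (Ann f) (add_monoid polyQ)"
  proof (rule Q.add.subgroupI)
    show "Ann f \<noteq> {}"
      by (auto simp: Ann_def intro!: exI[of _ 0])
    show "\<ominus>\<^bsub>polyQ\<^esub> \<alpha> \<in> Ann f" if "\<alpha> \<in> Ann f" for \<alpha>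
      using Ann_mult[OF that, of "-1"] by (simp add: type_algebra_minus)
  qed (simp_all add: Ann_add)
qed (metis Ann_mult mult.commute type_algebra_simps(3))+

text \<open>If \<open>\<alpha>(f)\<close> contains a monomial \<open>x\<^sup>m\<close>, then \<open>m\<close> has degree \<open>\<omega> - g\<close> and \<open>X\<^sup>m\<close> is an operator of
  that degree with \<open>(X\<^sup>m \<alpha>)(f)\<close> having constant term \<open>m!\<close> times the coefficient, which is
  nonzero in characteristic zero.\<close>

lemma apolarity_nondegenerate:
  fixes f :: "('v::finite, 'k::field_char_0) mpol" and d :: "'v \<Rightarrow> 'g::ab_group_add"
  assumes "f \<in> homog d \<omega>" "\<alpha> \<in> homog d g"
    and orth: "\<And>\<beta>. \<beta> \<in> homog d (\<omega> - g) \<Longrightarrow> const_act f (\<beta> * \<alpha>) = 0"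
  shows "\<alpha> \<in> Ann f"
proof (rule ccontr)
  assume "\<alpha> \<notin> Ann f"
  then obtain m where m: "m \<in> Poly_Mapping.keys (diff_act \<alpha> f)"
    by (auto simp: Ann_def simp flip: keys_eq_empty)
  define \<beta> :: "('v, 'k) mpol" where "\<beta> = Poly_Mapping.single m 1"
  have "diff_act \<alpha> f \<in> homog d (\<omega> - g)"
    by (rule homog_diff_act) fact+
  with m have "\<beta> \<in> homog d (\<omega> - g)"
    by (auto simp: \<beta>_def homog_def)
  from orth[OF this] have "dpc (diff_act \<alpha> f) m = 0"
    using diff_act_single[of m 1 "diff_act \<alpha> f" 0]
    by (simp add: const_act_def diff_act_mult \<beta>_def dpc_at_zero)
  with m show False using dpc_nonzero_iff by blast
qed

section \<open>The quotient by the annihilator and its dual bases\<close>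

locale apolar_algebra =
  fixes d :: "'v::finite \<Rightarrow> 'g::ab_group_add" and f :: "('v, 'k::field_char_0) mpol" and \<omega> :: 'g
  assumes graded: "graded_poly_ring d TYPE('k)"
    and homog_f: "f \<in> homog d \<omega>" and f_nonzero: "f \<noteq> 0"
begin

sublocale proper_mpol_ideal "Ann f"
  by (rule proper_mpol_ideal.intro[OF ideal_Ann]) (use f_nonzero in \<open>simp add: Ann_def\<close>)

lemma cls_act_cls: "cls_act (cls (Ann f) \<alpha>) f = diff_act \<alpha> f"
proof -
  have "(\<lambda>\<alpha>. diff_act \<alpha> f) ` cls (Ann f) \<alpha> = {diff_act \<alpha> f}"
  proof (rule Set.set_eqI, rule iffI)
    show "F \<in> {diff_act \<alpha> f}" if "F \<in> (\<lambda>\<alpha>. diff_act \<alpha> f) ` cls (Ann f) \<alpha>" for F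
      using that by (auto simp: a_r_coset_def' diff_act_add Ann_def)
    show "F \<in> (\<lambda>\<alpha>. diff_act \<alpha> f) ` cls (Ann f) \<alpha>" if "F \<in> {diff_act \<alpha> f}" for F
      using that I.zero_closed by (force simp: a_r_coset_def')
  qed
  then show ?thesis by (simp add: cls_act_def)
qed

lemma diff_act_degree_\<omega>:
  assumes "\<alpha> \<in> homog d \<omega>"
  shows "diff_act \<alpha> f = Const (const_act f \<alpha>)"
  using Const_lookup_of_homog_0[OF graded] homog_diff_act[OF assms homog_f]
  by (simp add: const_act_def)

text \<open>Classes in \<open>Q/Ann(f)\<close> are determined by their action on \<open>f\<close>; identities in the
  quotient thereby become identities of polynomials.\<close>

lemma cls_eq_iff_diff_act: "cls (Ann f) \<alpha> = cls (Ann f) \<beta> \<longleftrightarrow> diff_act \<alpha> f = diff_act \<beta> f"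
  unfolding cls_eq_iff by (simp add: Ann_def diff_act_minus)

lemma const_act_cong: "cls (Ann f) \<alpha> = cls (Ann f) \<beta> \<Longrightarrow> const_act f \<alpha> = const_act f \<beta>"
  by (simp add: cls_eq_iff_diff_act const_act_def)

text \<open>Pairing \<open>1\<close> with degree \<open>\<omega>\<close> yields, by nondegeneracy, an operator of degree \<open>\<omega>\<close> with
  nonzero constant value on \<open>f\<close>; rescaling gives the value \<open>1\<close>. Two such operators differ by an
  element of the annihilator, so the description determines the class.\<close>

lemma socle_gen_cls:
  obtains \<sigma> where "\<sigma> \<in> homog d \<omega>" "diff_act \<sigma> f = 1" "socle_gen d f \<omega> = cls (Ann f) \<sigma>"
proof -
  have one: "1 \<in> (homog d 0 :: ('v, 'k) mpol set)"
    by (auto simp: homog_def)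
  have "\<exists>\<beta>\<in>homog d (\<omega> - 0). const_act f (\<beta> * 1) \<noteq> 0"
    using apolarity_nondegenerate[OF homog_f one] proper by blast
  then obtain \<beta> where \<beta>: "\<beta> \<in> homog d \<omega>" "const_act f \<beta> \<noteq> 0" by auto
  define \<sigma> where "\<sigma> = Const (inverse (const_act f \<beta>)) * \<beta>"
  have \<sigma>: "\<sigma> \<in> homog d \<omega>"
    unfolding \<sigma>_def by (rule homog_Const_mult) fact
  moreover have act: "diff_act \<sigma> f = 1"
    using \<beta> by (simp add: \<sigma>_def diff_act_Const_mult diff_act_degree_\<omega> Const_inverse)
  moreover have "socle_gen d f \<omega> = cls (Ann f) \<sigma>"
    unfolding socle_gen_def
  proof (rule the_equality)
    show "cls (Ann f) \<sigma> \<in> piece d (Ann f) \<omega> \<and> cls_act (cls (Ann f) \<sigma>) f = 1"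
      using \<sigma> act by (simp add: piece_def cls_act_cls)
  next
    fix u assume "u \<in> piece d (Ann f) \<omega> \<and> cls_act u f = 1"
    then obtain \<alpha> where u: "u = cls (Ann f) \<alpha>" and "cls_act u f = 1"
      by (auto simp: piece_def)
    then show "u = cls (Ann f) \<sigma>"
      using act unfolding u cls_eq_iff_diff_act by (simp add: cls_act_cls)
  qed
  ultimately show ?thesis by (rule that)
qed

lemma basis_representatives:
  assumes "is_basis (Ann f) (piece d (Ann f) g) Bs"
  obtains \<beta>s where "Bs = map (cls (Ann f)) \<beta>s" "set \<beta>s \<subseteq> homog d g"
proof -
  have "set Bs \<subseteq> carrier (quot_alg (Ann f))"
    using assms A.independent_in_carrier unfolding is_basis_def by blast
  then have "set Bs \<subseteq> piece d (Ann f) g"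
    using assms A.Span_base_incl[OF subfield_scalars] unfolding is_basis_def by metis
  then have "\<forall>i<length Bs. \<exists>\<beta>. \<beta> \<in> homog d g \<and> Bs ! i = cls (Ann f) \<beta>"
    using nth_mem[of _ Bs] unfolding piece_def by blast
  then obtain \<beta> where \<beta>: "\<forall>i<length Bs. \<beta> i \<in> homog d g \<and> Bs ! i = cls (Ann f) (\<beta> i)"
    by metis
  show ?thesis
    by (rule that[of "map \<beta> [0..<length Bs]"]) (use \<beta> in \<open>auto intro: nth_equalityI\<close>)
qed

lemma is_basis_cls_iff:
  assumes "set \<beta>s \<subseteq> homog d g"
  shows "is_basis (Ann f) (piece d (Ann f) g) (map (cls (Ann f)) \<beta>s) \<longleftrightarrow>
    (\<forall>c. (\<Sum>i<length \<beta>s. Const (c i) * \<beta>s ! i) \<in> Ann f \<longrightarrow> (\<forall>i<length \<beta>s. c i = 0)) \<and>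
    (\<forall>\<alpha>\<in>homog d g. \<exists>c. cls (Ann f) \<alpha> = cls (Ann f) (\<Sum>i<length \<beta>s. Const (c i) * \<beta>s ! i))"
proof -
  have "(\<Sum>i<length \<beta>s. Const (c i) * \<beta>s ! i) \<in> homog d g" for c
    using assms nth_mem by (intro homog_sum homog_Const_mult) auto
  then have "A.Span (scalars (Ann f)) (map (cls (Ann f)) \<beta>s) \<subseteq> piece d (Ann f) g"
    unfolding Span_cls piece_def by blast
  moreover have "piece d (Ann f) g \<subseteq> A.Span (scalars (Ann f)) (map (cls (Ann f)) \<beta>s) \<longleftrightarrow>
     (\<forall>\<alpha>\<in>homog d g. \<exists>c. cls (Ann f) \<alpha> = cls (Ann f) (\<Sum>i<length \<beta>s. Const (c i) * \<beta>s ! i))"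
    unfolding Span_cls piece_def image_subset_iff by simp
  ultimately show ?thesis
    unfolding is_basis_def independent_cls_iff by blast
qed

text \<open>A basis of \<open>A\<^sub>h\<close> gives functionals \<open>\<alpha> \<mapsto> (\<alpha>\<gamma>\<^sub>j)(f)\<close> in degree \<open>\<omega> - h\<close>, independent by
  nondegeneracy on the side of \<open>A\<^sub>h\<close>; a dual family for them exists. Nondegeneracy on the other
  side shows that an element of \<open>A\<^bsub>\<omega>-h\<^esub>\<close> is determined by its values against the \<open>\<gamma>\<^sub>j\<close>, so
  the dual family spans and is unique. This justifies the definite description in
  \<^const>\<open>dual_basis\<close> and gives representatives of its value.\<close>

lemma dual_basis_cls:
  assumes \<gamma>s: "set \<gamma>s \<subseteq> homog d h" and basis: "is_basis (Ann f) (piece d (Ann f) h) (map (cls (Ann f)) \<gamma>s)"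
  obtains \<delta>s where "dual_basis d f \<omega> h (map (cls (Ann f)) \<gamma>s) = map (cls (Ann f)) \<delta>s"
    "length \<delta>s = length \<gamma>s" "set \<delta>s \<subseteq> homog d (\<omega> - h)"
    "\<And>i j. i < length \<gamma>s \<Longrightarrow> j < length \<gamma>s \<Longrightarrow>
       const_act f (\<delta>s ! i * \<gamma>s ! j) = (if i = j then 1 else 0)"
proof -
  let ?n = "length \<gamma>s" and ?cls = "cls (Ann f)"
  have \<gamma>_homog: "\<gamma>s ! j \<in> homog d h" if "j < ?n" for j
    using that \<gamma>s nth_mem by blast
  have indep: "\<forall>j<?n. c j = 0" if "(\<Sum>j<?n. Const (c j) * \<gamma>s ! j) \<in> Ann f" for c
    using basis that unfolding is_basis_cls_iff[OF \<gamma>s] by blast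
  have span: "\<exists>c. ?cls \<alpha> = ?cls (\<Sum>j<?n. Const (c j) * \<gamma>s ! j)" if "\<alpha> \<in> homog d h" for \<alpha>
    using basis that unfolding is_basis_cls_iff[OF \<gamma>s] by blast
  \<comment> \<open>Testing against the basis of \<open>A\<^sub>h\<close> suffices: any \<open>\<beta>\<close> of degree \<open>h\<close> is a combination of the
    \<open>\<gamma>\<^sub>j\<close> modulo the annihilator.\<close>
  have nondeg: "\<alpha> \<in> Ann f"
    if \<alpha>: "\<alpha> \<in> homog d (\<omega> - h)" and orth: "\<And>j. j < ?n \<Longrightarrow> const_act f (\<alpha> * \<gamma>s ! j) = 0" for \<alpha>
  proof (rule apolarity_nondegenerate[OF homog_f \<alpha>])
    fix \<beta> :: "('v, 'k) mpol" assume "\<beta> \<in> homog d (\<omega> - (\<omega> - h))"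
    then obtain c where "?cls \<beta> = ?cls (\<Sum>j<?n. Const (c j) * \<gamma>s ! j)"
      using span[of \<beta>] by auto
    then have "?cls (\<alpha> * \<beta>) = ?cls (\<alpha> * (\<Sum>j<?n. Const (c j) * \<gamma>s ! j))"
      unfolding cls_mult[symmetric] by simp
    then have "const_act f (\<alpha> * \<beta>) = (\<Sum>j<?n. c j * const_act f (\<alpha> * \<gamma>s ! j))"
      unfolding const_act_lincomb[symmetric] by (rule const_act_cong)
    then show "const_act f (\<beta> * \<alpha>) = 0"
      using orth by (simp add: mult.commute[of \<beta>])
  qed
  have "\<exists>\<delta>. (\<forall>i\<in>{..<?n}. \<delta> i \<in> homog d (\<omega> - h)) \<and>
    (\<forall>i\<in>{..<?n}. \<forall>j\<in>{..<?n}. const_act f (\<delta> i * \<gamma>s ! j) = (if i = j then 1 else 0))"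
  proof (rule mpol.dual_family)
    show "mpol.subspace (homog d (\<omega> - h) :: ('v, 'k) mpol set)"
      by (auto simp: mpol.subspace_def homog_add homog_Const_mult)
    fix c assume c: "\<And>\<alpha>. \<alpha> \<in> homog d (\<omega> - h) \<Longrightarrow> (\<Sum>j<?n. c j * const_act f (\<alpha> * \<gamma>s ! j)) = 0"
    have "(\<Sum>j<?n. Const (c j) * \<gamma>s ! j) \<in> Ann f"
    proof (rule apolarity_nondegenerate[OF homog_f])
      show "(\<Sum>j<?n. Const (c j) * \<gamma>s ! j) \<in> homog d h"
        by (intro homog_sum homog_Const_mult \<gamma>_homog) simp
      show "const_act f (\<beta> * (\<Sum>j<?n. Const (c j) * \<gamma>s ! j)) = 0" if "\<beta> \<in> homog d (\<omega> - h)" for \<beta>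
        using c[OF that] by (simp add: const_act_lincomb)
    qed
    then show "\<forall>j\<in>{..<?n}. c j = 0"
      using indep by blast
  qed (simp_all add: distrib_right const_act_add const_act_Const_mult mult.assoc)
  then obtain \<delta> where \<delta>: "\<And>i. i < ?n \<Longrightarrow> \<delta> i \<in> homog d (\<omega> - h)"
    "\<And>i j. i < ?n \<Longrightarrow> j < ?n \<Longrightarrow> const_act f (\<delta> i * \<gamma>s ! j) = (if i = j then 1 else 0)"
    by auto
  define \<delta>s where "\<delta>s = map \<delta> [0..<?n]"
  have len: "length \<delta>s = ?n" and nth: "\<And>i. i < ?n \<Longrightarrow> \<delta>s ! i = \<delta> i"
    by (simp_all add: \<delta>s_def)
  have \<delta>s: "set \<delta>s \<subseteq> homog d (\<omega> - h)"
    using \<delta>(1) by (auto simp: \<delta>s_def)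
  have dual: "const_act f (\<delta>s ! i * \<gamma>s ! j) = (if i = j then 1 else 0)" if "i < ?n" "j < ?n" for i j
    using \<delta>(2) that by (simp add: nth)
  obtain \<sigma> where \<sigma>: "\<sigma> \<in> homog d \<omega>" "diff_act \<sigma> f = 1" "socle_gen d f \<omega> = ?cls \<sigma>"
    by (rule socle_gen_cls)
  have prod_degree: "\<alpha> * \<gamma>s ! j \<in> homog d \<omega>" if "\<alpha> \<in> homog d (\<omega> - h)" "j < ?n" for \<alpha> j
    using homog_mult[OF that(1) \<gamma>_homog[OF that(2)]] by simp
  \<comment> \<open>Products land in degree \<open>\<omega>\<close>, where the constant value determines the class.\<close>
  have pairing: "?cls \<alpha> \<otimes>\<^bsub>quot_alg (Ann f)\<^esub> ?cls (\<gamma>s ! j) =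
        (if i = j then socle_gen d f \<omega> else \<zero>\<^bsub>quot_alg (Ann f)\<^esub>) \<longleftrightarrow>
      const_act f (\<alpha> * \<gamma>s ! j) = (if i = j then 1 else 0)"
    if "\<alpha> \<in> homog d (\<omega> - h)" "j < ?n" for \<alpha> and i j :: nat
  proof -
    have "diff_act (\<alpha> * \<gamma>s ! j) f = Const (const_act f (\<alpha> * \<gamma>s ! j))"
      by (rule diff_act_degree_\<omega>[OF prod_degree[OF that]])
    moreover have "Const c = (1 :: ('v, 'k) mpol) \<longleftrightarrow> c = 1" "Const c = (0 :: ('v, 'k) mpol) \<longleftrightarrow> c = 0" for c
      unfolding Const_def by (metis lookup_one_zero lookup_single_eq single_one, metis lookup_single_eq lookup_zero single_zero)
    ultimately show ?thesis
      by (simp only: cls_mult cls_zero \<sigma>(2,3) cls_eq_iff_diff_act diff_act_zero split: if_split)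
         blast
  qed
  \<comment> \<open>Independence: pair with \<open>\<gamma>\<^sub>i\<close>. Spanning: \<open>\<alpha> - \<Sum>\<^sub>i (\<alpha>\<gamma>\<^sub>i)(f) \<delta>\<^sub>i\<close> pairs to zero with every \<open>\<gamma>\<^sub>j\<close>.\<close>
  have basis_\<delta>: "is_basis (Ann f) (piece d (Ann f) (\<omega> - h)) (map ?cls \<delta>s)"
    unfolding is_basis_cls_iff[OF \<delta>s] len
  proof (intro conjI allI impI ballI)
    fix c i assume c: "(\<Sum>i<?n. Const (c i) * \<delta>s ! i) \<in> Ann f" and i: "i < ?n"
    have "0 = const_act f (\<gamma>s ! i * (\<Sum>i<?n. Const (c i) * \<delta>s ! i))"
      using c by (simp add: const_act_Ann Ann_mult)
    also have "\<dots> = (\<Sum>j<?n. if j = i then c j else 0)"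
      unfolding const_act_lincomb using dual[OF _ i] by (intro sum.cong) (simp_all add: mult.commute)
    also have "\<dots> = c i"
      using i by simp
    finally show "c i = 0" by simp
  next
    fix \<alpha> :: "('v, 'k) mpol" assume \<alpha>: "\<alpha> \<in> homog d (\<omega> - h)"
    let ?c = "\<lambda>i. const_act f (\<alpha> * \<gamma>s ! i)"
    let ?\<beta> = "\<Sum>i<?n. Const (?c i) * \<delta>s ! i"
    have "\<alpha> - ?\<beta> \<in> Ann f"
    proof (rule nondeg)
      have "?\<beta> \<in> homog d (\<omega> - h)"
        using \<delta>s nth_mem len by (intro homog_sum homog_Const_mult) auto
      from homog_Const_mult[OF this, of "-1"] homog_add[OF \<alpha>]
      have "\<alpha> + Const (-1) * ?\<beta> \<in> homog d (\<omega> - h)" by blast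
      then show "\<alpha> - ?\<beta> \<in> homog d (\<omega> - h)" by (simp add: Const_def single_uminus)
      fix j assume j: "j < ?n"
      have "const_act f (?\<beta> * \<gamma>s ! j) = (\<Sum>i<?n. if i = j then ?c i else 0)"
        unfolding mult.commute[of ?\<beta>] const_act_lincomb
        using dual[OF _ j] by (intro sum.cong) (simp_all add: mult.commute)
      also have "\<dots> = ?c j" using j by simp
      finally show "const_act f ((\<alpha> - ?\<beta>) * \<gamma>s ! j) = 0"
        using const_act_add[of f "(\<alpha> - ?\<beta>) * \<gamma>s ! j" "?\<beta> * \<gamma>s ! j"] by (simp add: algebra_simps)
    qed
    then show "\<exists>c. ?cls \<alpha> = ?cls (\<Sum>i<?n. Const (c i) * \<delta>s ! i)"
      unfolding cls_eq_iff by (rule exI[of _ ?c])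
  qed
  have "dual_basis d f \<omega> h (map ?cls \<gamma>s) = map ?cls \<delta>s"
    unfolding dual_basis_def
  proof (rule the_equality, goal_cases)
    case 1
    then show ?case
      using basis_\<delta> len \<delta>s dual pairing[of "\<delta>s ! _"] nth_mem[of _ \<delta>s]
      by (auto simp: subset_iff)
  next
    case (2 Ds)
    then obtain \<eta>s where \<eta>s: "Ds = map ?cls \<eta>s" "set \<eta>s \<subseteq> homog d (\<omega> - h)"
      using basis_representatives by metis
    have len_\<eta>: "length \<eta>s = ?n" using 2 \<eta>s by simp
    have "?cls (\<eta>s ! i) = ?cls (\<delta>s ! i)" if i: "i < ?n" for i
      unfolding cls_eq_iff
    proof (rule nondeg)
      have \<eta>i: "\<eta>s ! i \<in> homog d (\<omega> - h)" and \<delta>i: "\<delta>s ! i \<in> homog d (\<omega> - h)"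
        using i len len_\<eta> \<eta>s(2) \<delta>s nth_mem by auto
      from homog_add[OF \<eta>i homog_Const_mult[OF \<delta>i, of "-1"]]
      show "\<eta>s ! i - \<delta>s ! i \<in> homog d (\<omega> - h)" by (simp add: Const_def single_uminus)
      fix j assume j: "j < ?n"
      have "const_act f (\<eta>s ! i * \<gamma>s ! j) = (if i = j then 1 else 0)"
        using 2 i j \<eta>s(1) len_\<eta> pairing[OF \<eta>i j, of i] by simp
      with dual[OF i j] const_act_add[of f "(\<eta>s ! i - \<delta>s ! i) * \<gamma>s ! j" "\<delta>s ! i * \<gamma>s ! j"]
      show "const_act f ((\<eta>s ! i - \<delta>s ! i) * \<gamma>s ! j) = 0"
        by (simp add: algebra_simps split: if_splits)
    qed
    then show "Ds = map ?cls \<delta>s"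
      using \<eta>s(1) len len_\<eta> by (auto intro: nth_equalityI)
  qed
  from that[OF this len \<delta>s dual] show ?thesis by blast
qed

end

section \<open>Multiplication by a power of a linear form\<close>

text \<open>For \<open>f = 0\<close> the quotient is the zero ring, which has no subspace of dimension one.\<close>

lemma nonzero_of_cox_gorenstein:
  fixes f :: "('v::finite, 'k::field_char_0) mpol"
  assumes "cox_gorenstein d (Ann f) \<omega>"
  shows "f \<noteq> 0"
proof
  assume "f = 0"
  then have Ann: "Ann f = UNIV" by (simp add: Ann_def)
  interpret A: ring "quot_alg (Ann f)"
    by (rule ideal.quotient_is_ring[OF ideal_Ann])
  have "A.dimension 1 (scalars (Ann f)) (piece d (Ann f) \<omega>)"
    using assms by (simp add: cox_gorenstein_def)
  then obtain v E where v: "v \<in> carrier (quot_alg (Ann f))" "v \<notin> E" and E: "A.dimension 0 (scalars (Ann f)) E"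
    by (cases rule: A.dimension.cases) auto
  from E have "E = {\<zero>\<^bsub>quot_alg (Ann f)\<^esub>}"
    by (cases rule: A.dimension.cases) auto
  moreover have cls: "u = UNIV" if "u \<in> carrier (quot_alg (Ann f))" for u
    using that by (auto simp: FactRing_def A_RCOSETS_defs RCOSETS_def r_coset_def Ann)
      (metis diff_add_cancel)
  ultimately show False
    using v cls[OF v(1)] cls[OF A.zero_closed] by simp
qed

theorem theorem5p10:
  fixes d :: "'v::finite \<Rightarrow> 'g::ordered_ab_group_add"
    and f :: "('v, 'k::field_char_0) mpol"
    and \<phi> :: "'g \<Rightarrow> rat"
    and \<omega> g h l :: 'g
    and k :: nat
    and a :: "'v \<Rightarrow> 'k"
    and L :: "('v, 'k) mpol set"
    and B C :: "('v, 'k) mpol set list"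
  assumes "graded_poly_ring d TYPE('k)"
    and "f \<in> homog d \<omega>"
    and "artinian_ring (quot_alg (Ann f))"
    and "cox_gorenstein d (Ann f) \<omega>"
    and "linearly_comparable d (Ann f) g h"
    and "h = g + nat_mult k l"
    and "Modules.additive \<phi>"
    and "\<phi> \<omega> \<in> \<nat>"
    and "L = cls (Ann f) (\<Sum>i | d i = l. Const (a i) * Var i)"
    and "phi_linear d (Ann f) \<phi> l L"
    and "is_basis (Ann f) (piece d (Ann f) g) B"
    and "is_basis (Ann f) (piece d (Ann f) h) C"
  shows "matrix_of (Ann f) B C (\<lambda>u. u \<otimes>\<^bsub>quot_alg (Ann f)\<^esub> (L [^]\<^bsub>quot_alg (Ann f)\<^esub> k))
       = fact k \<cdot>\<^sub>m map_mat (eval_at (\<lambda>i. if d i = l then a i else 0))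
           (mixed_hessian f (dual_basis d f \<omega> h C) B)"
proof -
  interpret apolar_algebra d f \<omega>
    using assms(1,2) nonzero_of_cox_gorenstein[OF assms(4)] by unfold_locales
  let ?cls = "cls (Ann f)"
  define lf :: "('v, 'k) mpol" where "lf = (\<Sum>i | d i = l. Const (a i) * Var i)"
  have L_pow: "L [^]\<^bsub>quot_alg (Ann f)\<^esub> k = ?cls (lf ^ k)"
    unfolding assms(9) cls_pow lf_def ..
  have "lf \<in> homog d l"
    unfolding lf_def
    by (intro homog_sum homog_Const_mult) (auto simp: Var_def homog_def mon_deg_single[simplified])
  then have lf_pow: "lf ^ k \<in> homog d (nat_mult k l)"
    by (rule homog_power)
  obtain \<beta>s where \<beta>s: "B = map ?cls \<beta>s" "set \<beta>s \<subseteq> homog d g"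
    using basis_representatives[OF assms(11)] .
  obtain \<gamma>s where \<gamma>s: "C = map ?cls \<gamma>s" "set \<gamma>s \<subseteq> homog d h"
    using basis_representatives[OF assms(12)] .
  obtain \<delta>s where \<delta>s: "dual_basis d f \<omega> h (map ?cls \<gamma>s) = map ?cls \<delta>s"
    "length \<delta>s = length \<gamma>s" "set \<delta>s \<subseteq> homog d (\<omega> - h)"
    and dual: "\<And>i j. i < length \<gamma>s \<Longrightarrow> j < length \<gamma>s \<Longrightarrow>
       const_act f (\<delta>s ! i * \<gamma>s ! j) = (if i = j then 1 else 0)"
    using dual_basis_cls[OF \<gamma>s(2) assms(12)[unfolded \<gamma>s(1)]] by metis
  have C_indep: "A.independent (scalars (Ann f)) (map ?cls \<gamma>s)"
    using assms(12) by (simp add: is_basis_def \<gamma>s(1))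
  \<comment> \<open>Pairing \<open>\<beta>\<^sub>j L\<^sup>k = \<Sum>\<^sub>i c\<^sub>i \<gamma>\<^sub>i\<close> with \<open>\<delta>\<^sub>i\<close> isolates \<open>c\<^sub>i\<close>.\<close>
  have entry: "coords (Ann f) C (?cls (\<beta>s ! j) \<otimes>\<^bsub>quot_alg (Ann f)\<^esub> (L [^]\<^bsub>quot_alg (Ann f)\<^esub> k)) ! i =
      fact k * eval_at (\<lambda>i. if d i = l then a i else 0) (diff_act (\<delta>s ! i * \<beta>s ! j) f)"
    if i: "i < length \<gamma>s" and j: "j < length \<beta>s" for i j
  proof -
    have \<beta>j: "\<beta>s ! j \<in> homog d g" and \<delta>i: "\<delta>s ! i \<in> homog d (\<omega> - h)"
      using i j \<beta>s(2) \<delta>s(2,3) nth_mem by auto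
    have "\<beta>s ! j * lf ^ k \<in> homog d h"
      unfolding assms(6) by (rule homog_mult[OF \<beta>j lf_pow])
    then obtain c where c: "?cls (\<beta>s ! j * lf ^ k) = ?cls (\<Sum>i<length \<gamma>s. Const (c i) * \<gamma>s ! i)"
      using assms(12) unfolding \<gamma>s(1) is_basis_cls_iff[OF \<gamma>s(2)] by blast
    have "coords (Ann f) C (?cls (\<beta>s ! j) \<otimes>\<^bsub>quot_alg (Ann f)\<^esub> (L [^]\<^bsub>quot_alg (Ann f)\<^esub> k)) ! i = c i"
      unfolding L_pow cls_mult c \<gamma>s(1) coords_cls[OF C_indep] using i by simp
    also have "c i = (\<Sum>j<length \<gamma>s. if i = j then c j else 0)"
      using i by simp
    also have "\<dots> = const_act f (\<delta>s ! i * (\<Sum>i<length \<gamma>s. Const (c i) * \<gamma>s ! i))"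
      unfolding const_act_lincomb using dual[OF i] by (intro sum.cong) auto
    also have "\<dots> = const_act f (\<delta>s ! i * (\<beta>s ! j * lf ^ k))"
      by (rule const_act_cong) (simp only: c cls_mult[of "\<delta>s ! i", symmetric])
    also have "\<dots> = Poly_Mapping.lookup (diff_act (lf ^ k) (diff_act (\<delta>s ! i * \<beta>s ! j) f)) 0"
      by (simp add: const_act_def mult_ac flip: diff_act_mult)
    also have "\<dots> = fact k * eval_at (\<lambda>i. if d i = l then a i else 0) (diff_act (\<delta>s ! i * \<beta>s ! j) f)"
      unfolding lf_def
    proof (rule linear_form_power_act_homog[OF assms(7)])
      show "\<phi> l = 1"
        using assms(10) by (simp add: phi_linear_def)
      \<comment> \<open>The Hessian entry is homogeneous of degree \<open>h - g\<close>.\<close>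
      have "\<omega> - ((\<omega> - h) + g) = nat_mult k l"
        by (simp add: assms(6) algebra_simps)
      then show "diff_act (\<delta>s ! i * \<beta>s ! j) f \<in> homog d (nat_mult k l)"
        using homog_diff_act[OF homog_mult[OF \<delta>i \<beta>j] homog_f] by simp
    qed
    finally show ?thesis .
  qed
  show ?thesis
  proof (rule eq_matI)
    fix i j
    assume "i < dim_row (fact k \<cdot>\<^sub>m map_mat (eval_at (\<lambda>i. if d i = l then a i else 0))
        (mixed_hessian f (dual_basis d f \<omega> h C) B))"
      and "j < dim_col (fact k \<cdot>\<^sub>m map_mat (eval_at (\<lambda>i. if d i = l then a i else 0))
        (mixed_hessian f (dual_basis d f \<omega> h C) B))"
    then have i: "i < length \<gamma>s" and j: "j < length \<beta>s"
      by (simp_all add: mixed_hessian_def \<gamma>s(1) \<delta>s(1,2) \<beta>s(1))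
    show "matrix_of (Ann f) B C (\<lambda>u. u \<otimes>\<^bsub>quot_alg (Ann f)\<^esub> (L [^]\<^bsub>quot_alg (Ann f)\<^esub> k)) $$ (i, j) =
        (fact k \<cdot>\<^sub>m map_mat (eval_at (\<lambda>i. if d i = l then a i else 0))
          (mixed_hessian f (dual_basis d f \<omega> h C) B)) $$ (i, j)"
      using i j entry[OF i j]
      by (simp add: matrix_of_def mat_of_cols_list_def mixed_hessian_def \<delta>s(1,2) \<beta>s(1) \<gamma>s(1) cls_mult cls_act_cls)
  qed (simp_all add: matrix_of_def mat_of_cols_list_def mixed_hessian_def \<delta>s(1,2) \<beta>s(1) \<gamma>s(1))
qed

end
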